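(* Let $F=\mathbb{F}_q$ with $q$ a prime power, let $L$ be an extension of $F$ of degree $r$ where $r$ is prime, and let $\sigma$ be a generator of $\mathrm{Gal}(L/F)$. Define an equivalence relation on $L\setminus F$ by $a\sim b$ if and only if $(L/F,\sigma,a)\cong(L/F,\sigma,b)$ as $F$-algebras. If $r$ divides $q-1$ then there are exactly $$r-1+\frac{q^r-q-(q-1)(r-1)}{r(q-1)}$$ equivalence classes of $\sim$. If $r$ does not divide $q-1$ then there are precisely $$\frac{q^r-q}{r(q-1)}$$ equivalence classes.
   Context: For a cyclic Galois field extension $L/F$ of degree $n$ with Galois group generated by $\sigma$ and $a\in L\setminus F$, the nonassociative cyclic algebra $(L/F,\sigma,a)$ is the $L$-vector space $\bigoplus_{i=0}^{n-1}Lz^i$ with basis of formal symbols $z^0=1,z,\dots,z^{n-1}$ and multiplication defined, for $l,m\in L$ and $0\le i,j<n$, by $(lz^i)(mz^j)=l\sigma^i(m)z^{i+j}$ if $i+j<n$ and $(lz^i)(mz^j)=l\sigma^i(m)a\,z^{i+j-n}$ if $i+j\ge n$, extended additively in both arguments. It is an $F$-algebra. *)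

theory Defs
  imports
    "HOL-Algebra.Algebra"
    "HOL-Number_Theory.Prime_Powers"
begin

section \<open>Galois groups\<close>

text \<open>
  As in \<^const>\<open>BijGroup\<close>, automorphisms are taken to be extensional on the carrier, so
  that each automorphism is represented by exactly one HOL function.
\<close>

definition galois_group :: "('a, 'm) ring_scheme \<Rightarrow> 'a set \<Rightarrow> ('a \<Rightarrow> 'a) monoid"
  where "galois_group L F =
    BijGroup (carrier L)
      \<lparr>carrier := {\<tau> \<in> Bij (carrier L). \<tau> \<in> ring_hom L L \<and> (\<forall>x\<in>F. \<tau> x = x)}\<rparr>"


section \<open>Nonassociative cyclic algebras\<close>

definition ext_degree :: "('a, 'm) ring_scheme \<Rightarrow> 'a set \<Rightarrow> nat"
  where "ext_degree L F = ring.dim L F (carrier L)"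

text \<open>
  An element \<open>x\<^sub>0 + x\<^sub>1 z + \<dots> + x\<^bsub>n-1\<^esub> z\<^bsup>n-1\<^esup>\<close> is represented by its coefficient
  function on \<open>{..<n}\<close>; \<open>cyc_monom L n l i\<close> is \<open>l z\<^bsup>i\<^esup>\<close>.
\<close>

definition cyc_monom :: "('a, 'm) ring_scheme \<Rightarrow> nat \<Rightarrow> 'a \<Rightarrow> nat \<Rightarrow> (nat \<Rightarrow> 'a)"
  where "cyc_monom L n l i = (\<lambda>k\<in>{..<n}. if k = i then l else \<zero>\<^bsub>L\<^esub>)"

definition cyc_monom_mult ::
    "('a, 'm) ring_scheme \<Rightarrow> nat \<Rightarrow> ('a \<Rightarrow> 'a) \<Rightarrow> 'a \<Rightarrow> 'a \<Rightarrow> nat \<Rightarrow> 'a \<Rightarrow> nat \<Rightarrow> (nat \<Rightarrow> 'a)"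
  where "cyc_monom_mult L n \<sigma> a l i m j =
    (if i + j < n
     then cyc_monom L n (l \<otimes>\<^bsub>L\<^esub> (\<sigma> ^^ i) m) (i + j)
     else cyc_monom L n (l \<otimes>\<^bsub>L\<^esub> (\<sigma> ^^ i) m \<otimes>\<^bsub>L\<^esub> a) (i + j - n))"

text \<open>
  The algebra \<open>(L/F, \<sigma>, a)\<close>. The record type \<^typ>\<open>('a, 'b) module\<close> only provides the
  operations; its multiplication is in general not associative. Scalar multiplication is
  defined for all of \<open>L\<close> (left multiplication), the \<open>F\<close>-algebra structure being its
  restriction to \<open>F\<close>.
\<close>

definition nonassoc_cyclic_algebra ::
    "('a, 'm) ring_scheme \<Rightarrow> 'a set \<Rightarrow> ('a \<Rightarrow> 'a) \<Rightarrow> 'a \<Rightarrow> ('a, nat \<Rightarrow> 'a) module"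
  where "nonassoc_cyclic_algebra L F \<sigma> a =
    (let n = ext_degree L F in
     \<lparr>carrier = {..<n} \<rightarrow>\<^sub>E carrier L,
      monoid.mult = (\<lambda>x y. \<lambda>k\<in>{..<n}.
        \<Oplus>\<^bsub>L\<^esub>i\<in>{..<n}. \<Oplus>\<^bsub>L\<^esub>j\<in>{..<n}. cyc_monom_mult L n \<sigma> a (x i) i (y j) j k),
      one = cyc_monom L n \<one>\<^bsub>L\<^esub> 0,
      ring.zero = (\<lambda>k\<in>{..<n}. \<zero>\<^bsub>L\<^esub>),
      add = (\<lambda>x y. \<lambda>k\<in>{..<n}. x k \<oplus>\<^bsub>L\<^esub> y k),
      smult = (\<lambda>c x. \<lambda>k\<in>{..<n}. c \<otimes>\<^bsub>L\<^esub> x k)\<rparr>)"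


section \<open>Isomorphism of algebras\<close>

text \<open>
  \<^const>\<open>ring_iso\<close> does not presuppose associativity. It asks for the unit to be preserved,
  which is automatic for a multiplicative bijection between unital algebras.
\<close>

definition algebra_iso ::
    "'a set \<Rightarrow> ('a, 'b, 'm) module_scheme \<Rightarrow> ('a, 'c, 'n) module_scheme \<Rightarrow> ('b \<Rightarrow> 'c) set"
  where "algebra_iso F A B =
    {h \<in> ring_iso A B. \<forall>c\<in>F. \<forall>x\<in>carrier A. h (c \<odot>\<^bsub>A\<^esub> x) = c \<odot>\<^bsub>B\<^esub> h x}"

definition cyclic_algebra_rel ::
    "('a, 'm) ring_scheme \<Rightarrow> 'a set \<Rightarrow> ('a \<Rightarrow> 'a) \<Rightarrow> ('a \<times> 'a) set"
  where "cyclic_algebra_rel L F \<sigma> =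
    {(a, b). a \<in> carrier L - F \<and> b \<in> carrier L - F \<and>
       algebra_iso F (nonassoc_cyclic_algebra L F \<sigma> a) (nonassoc_cyclic_algebra L F \<sigma> b) \<noteq> {}}"


section \<open>Basic properties\<close>

lemma funpow_mem:
  assumes "\<sigma> \<in> A \<rightarrow> A" "x \<in> A"
  shows "(\<sigma> ^^ i) x \<in> A"
  using assms by (induction i) auto

lemma cyc_monom_mult_closed:
  assumes "ring L" "\<sigma> \<in> carrier L \<rightarrow> carrier L" "a \<in> carrier L"
    and "l \<in> carrier L" "m \<in> carrier L" "k < n"
  shows "cyc_monom_mult L n \<sigma> a l i m j k \<in> carrier L"
proof -
  interpret ring L by fact
  have "(\<sigma> ^^ i) m \<in> carrier L"
    using assms by (intro funpow_mem)
  then show ?thesis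
    using assms by (auto simp: cyc_monom_mult_def cyc_monom_def)
qed

text \<open>The defining multiplication rule on monomials.\<close>

lemma nonassoc_cyclic_algebra_monom_mult:
  assumes "ring L" "\<sigma> \<in> ring_hom L L" "a \<in> carrier L"
    and "l \<in> carrier L" "m \<in> carrier L"
    and n: "n = ext_degree L F" and "i < n" "j < n"
  shows "cyc_monom L n l i \<otimes>\<^bsub>nonassoc_cyclic_algebra L F \<sigma> a\<^esub> cyc_monom L n m j =
    cyc_monom_mult L n \<sigma> a l i m j"
proof -
  interpret ring L by fact
  have \<sigma>: "\<sigma> \<in> carrier L \<rightarrow> carrier L"
    using assms(2) ring_hom_closed by fastforce
  have "\<sigma> \<zero>\<^bsub>L\<^esub> = \<zero>\<^bsub>L\<^esub>"
    using assms(2) ring_hom_zero ring_axioms by blast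
  then have z: "(\<sigma> ^^ i') \<zero>\<^bsub>L\<^esub> = \<zero>\<^bsub>L\<^esub>" for i'
    by (induction i') auto
  have pm: "(\<sigma> ^^ i') x \<in> carrier L" if "x \<in> carrier L" for i' x
    using funpow_mem[OF \<sigma> that] .
  have *: "(\<Oplus>\<^bsub>L\<^esub>i'\<in>{..<n}. \<Oplus>\<^bsub>L\<^esub>j'\<in>{..<n}.
      cyc_monom_mult L n \<sigma> a (cyc_monom L n l i i') i' (cyc_monom L n m j j') j' k)
    = cyc_monom_mult L n \<sigma> a l i m j k" (is "?S = ?R") if "k < n" for k
  proof -
    have R: "?R \<in> carrier L"
      using cyc_monom_mult_closed[OF assms(1) \<sigma> assms(3-5) that] .
    have inner: "cyc_monom_mult L n \<sigma> a (cyc_monom L n l i i') i' (cyc_monom L n m j j') j' k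
      = (if i = i' then (if j = j' then ?R else \<zero>\<^bsub>L\<^esub>) else \<zero>\<^bsub>L\<^esub>)"
      if "i' < n" "j' < n" for i' j'
      using that assms(3-5) \<open>k < n\<close> z pm
      by (auto simp: cyc_monom_mult_def cyc_monom_def)
    have "?S = (\<Oplus>\<^bsub>L\<^esub>i'\<in>{..<n}. if i = i' then ?R else \<zero>\<^bsub>L\<^esub>)"
    proof (intro finsum_cong' refl)
      fix i' assume "i' \<in> {..<n}"
      then have "(\<Oplus>\<^bsub>L\<^esub>j'\<in>{..<n}.
          cyc_monom_mult L n \<sigma> a (cyc_monom L n l i i') i' (cyc_monom L n m j j') j' k)
        = (\<Oplus>\<^bsub>L\<^esub>j'\<in>{..<n}. if j = j' then (if i = i' then ?R else \<zero>\<^bsub>L\<^esub>) else \<zero>\<^bsub>L\<^esub>)"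
        using R by (intro finsum_cong') (auto simp: inner)
      also have "\<dots> = (if i = i' then ?R else \<zero>\<^bsub>L\<^esub>)"
        by (rule finsum_singleton[of j "{..<n}" "\<lambda>_. if i = i' then ?R else \<zero>\<^bsub>L\<^esub>"])
          (use R \<open>j < n\<close> in auto)
      finally show "(\<Oplus>\<^bsub>L\<^esub>j'\<in>{..<n}.
          cyc_monom_mult L n \<sigma> a (cyc_monom L n l i i') i' (cyc_monom L n m j j') j' k)
        = (if i = i' then ?R else \<zero>\<^bsub>L\<^esub>)" .
    qed (use R in auto)
    also have "\<dots> = ?R"
      using R \<open>i < n\<close> finsum_singleton[of i "{..<n}" "\<lambda>_. ?R"] by auto
    finally show ?thesis .
  qed
  have ext: "cyc_monom_mult L n \<sigma> a l i m j \<in> extensional {..<n}"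
    by (auto simp: cyc_monom_mult_def cyc_monom_def)
  show ?thesis
    unfolding nonassoc_cyclic_algebra_def Let_def n[symmetric] monoid.simps
    by (rule extensionalityI[of _ "{..<n}"]) (use * ext in auto)
qed

lemma nonassoc_cyclic_algebra_closed:
  fixes L :: "('a, 'm) ring_scheme" and F :: "'a set"
  assumes "ring L" "\<sigma> \<in> carrier L \<rightarrow> carrier L" "a \<in> carrier L"
  defines "A \<equiv> nonassoc_cyclic_algebra L F \<sigma> a"
  shows "\<one>\<^bsub>A\<^esub> \<in> carrier A"
    "\<lbrakk>x \<in> carrier A; y \<in> carrier A\<rbrakk> \<Longrightarrow> x \<otimes>\<^bsub>A\<^esub> y \<in> carrier A"
    "\<lbrakk>x \<in> carrier A; y \<in> carrier A\<rbrakk> \<Longrightarrow> x \<oplus>\<^bsub>A\<^esub> y \<in> carrier A"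
    "\<lbrakk>c \<in> carrier L; x \<in> carrier A\<rbrakk> \<Longrightarrow> c \<odot>\<^bsub>A\<^esub> x \<in> carrier A"
proof -
  interpret ring L by fact
  have A: "carrier A = {..<ext_degree L F} \<rightarrow>\<^sub>E carrier L"
    by (simp add: A_def nonassoc_cyclic_algebra_def Let_def)
  show "\<one>\<^bsub>A\<^esub> \<in> carrier A"
    unfolding A by (auto simp: A_def nonassoc_cyclic_algebra_def Let_def cyc_monom_def)
  show "x \<otimes>\<^bsub>A\<^esub> y \<in> carrier A" if "x \<in> carrier A" "y \<in> carrier A"
    using that assms(1-3) unfolding A
    by (auto simp: A_def nonassoc_cyclic_algebra_def Let_def
        intro!: finsum_closed cyc_monom_mult_closed)
  show "x \<oplus>\<^bsub>A\<^esub> y \<in> carrier A" if "x \<in> carrier A" "y \<in> carrier A"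
    using that unfolding A by (auto simp: A_def nonassoc_cyclic_algebra_def Let_def)
  show "c \<odot>\<^bsub>A\<^esub> x \<in> carrier A" if "c \<in> carrier L" "x \<in> carrier A"
    using that unfolding A by (auto simp: A_def nonassoc_cyclic_algebra_def Let_def)
qed

lemma equiv_cyclic_algebra_rel:
  assumes "ring L" "F \<subseteq> carrier L" "\<sigma> \<in> carrier L \<rightarrow> carrier L"
  shows "equiv (carrier L - F) (cyclic_algebra_rel L F \<sigma>)"
proof (rule equivI)
  let ?A = "nonassoc_cyclic_algebra L F \<sigma>"
  show "cyclic_algebra_rel L F \<sigma> \<subseteq> (carrier L - F) \<times> (carrier L - F)"
    by (auto simp: cyclic_algebra_rel_def)
  show "refl_on (carrier L - F) (cyclic_algebra_rel L F \<sigma>)"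
  proof (rule refl_onI)
    fix a assume "a \<in> carrier L - F"
    moreover have "id \<in> algebra_iso F (?A a) (?A a)"
      by (auto simp: algebra_iso_def ring_iso_def ring_hom_def)
    ultimately show "(a, a) \<in> cyclic_algebra_rel L F \<sigma>"
      by (auto simp: cyclic_algebra_rel_def)
  qed
  show "sym (cyclic_algebra_rel L F \<sigma>)"
  proof (rule symI)
    fix a b assume ab: "(a, b) \<in> cyclic_algebra_rel L F \<sigma>"
    then obtain h where h: "h \<in> algebra_iso F (?A a) (?A b)"
      and a: "a \<in> carrier L" and b: "b \<in> carrier L"
      by (auto simp: cyclic_algebra_rel_def)
    note closed = nonassoc_cyclic_algebra_closed[OF assms(1,3) a]
    define g where "g = inv_into (carrier (?A a)) h"
    have bij: "bij_betw h (carrier (?A a)) (carrier (?A b))"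
      and hom: "h \<in> ring_hom (?A a) (?A b)"
      and lin: "\<And>c x. c \<in> F \<Longrightarrow> x \<in> carrier (?A a) \<Longrightarrow> h (c \<odot>\<^bsub>?A a\<^esub> x) = c \<odot>\<^bsub>?A b\<^esub> h x"
      using h by (auto simp: algebra_iso_def ring_iso_def)
    have g: "g y \<in> carrier (?A a)" "h (g y) = y" if "y \<in> carrier (?A b)" for y
      using that bij bij_betw_inv_into_right[OF bij that] bij_betw_imp_surj_on[OF bij]
      by (auto simp: g_def inv_into_into)
    have gI: "g y = x" if "h x = y" "x \<in> carrier (?A a)" for x y
      using that bij by (auto simp: g_def bij_betw_inv_into_left)
    have "g \<in> ring_hom (?A b) (?A a)"
      using ring_hom_one[OF hom]
      by (intro ring_hom_memI gI) (simp_all add: g closed ring_hom_mult[OF hom] ring_hom_add[OF hom])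
    moreover have "g (c \<odot>\<^bsub>?A b\<^esub> y) = c \<odot>\<^bsub>?A a\<^esub> g y" if "c \<in> F" "y \<in> carrier (?A b)" for c y
      using that assms(2) by (intro gI) (auto simp: lin g closed(4))
    ultimately have "g \<in> algebra_iso F (?A b) (?A a)"
      using bij_betw_inv_into[OF bij] by (auto simp: algebra_iso_def ring_iso_def g_def)
    with ab show "(b, a) \<in> cyclic_algebra_rel L F \<sigma>"
      by (auto simp: cyclic_algebra_rel_def)
  qed
  show "trans (cyclic_algebra_rel L F \<sigma>)"
  proof (rule transI)
    fix a b c
    assume ab: "(a, b) \<in> cyclic_algebra_rel L F \<sigma>" and bc: "(b, c) \<in> cyclic_algebra_rel L F \<sigma>"
    obtain g h where "g \<in> algebra_iso F (?A a) (?A b)" "h \<in> algebra_iso F (?A b) (?A c)"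
      using ab bc by (auto simp: cyclic_algebra_rel_def)
    then have "h \<circ> g \<in> algebra_iso F (?A a) (?A c)"
      by (auto simp: algebra_iso_def ring_iso_def ring_hom_closed
          intro: ring_hom_trans bij_betw_trans)
    with ab bc show "(a, c) \<in> cyclic_algebra_rel L F \<sigma>"
      by (auto simp: cyclic_algebra_rel_def)
  qed
qed

end

theory Submission
  imports Defs "HOL-Number_Theory.Cong"
begin

text \<open>
  The left nucleus of \<open>(L/F, \<sigma>, a)\<close> with \<open>a \<notin> F\<close> is \<open>L\<close>. An isomorphism onto \<open>(L/F, \<sigma>, b)\<close>
  therefore restricts to some \<open>\<tau> \<in> Gal(L/F)\<close>, and comparing \<open>z l = \<sigma>(l) z\<close> with its image shows that
  \<open>z\<close> is sent to \<open>k z\<close> with \<open>k \<in> L\<^sup>\<times>\<close>; then \<open>z z\<^bsup>r-1\<^esup> = a\<close> yields \<open>\<tau>(a) = N(k) b\<close>. Conversely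
  every such pair \<open>(\<tau>, k)\<close> defines an isomorphism. Since the norm of finite fields is surjective,
  the classes are the orbits of \<open>Gal(L/F) \<times> F\<^sup>\<times>\<close> on \<open>L - F\<close>, where \<open>Gal(L/F)\<close> is generated by
  \<open>x \<mapsto> x\<^sup>q\<close>. As \<open>r\<close> is prime, the stabiliser of \<open>a\<close> is trivial unless \<open>a\<^sup>q = d a\<close> for some
  \<open>d \<in> F\<close>, that is \<open>a\<close> to the power \<open>(q-1)\<^sup>2\<close> is \<open>1\<close>; in that case the orbit is \<open>F\<^sup>\<times> a\<close>. Such \<open>a\<close>
  are counted in the cyclic group \<open>L\<^sup>\<times>\<close>: there are \<open>(q-1)(gcd(r, q-1) - 1)\<close> of them outside \<open>F\<close>.
\<close>

section \<open>Vector spaces over subfields and the Frobenius map\<close>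

text \<open>Since \<open>a\<close> lies outside \<open>E\<close>, the sum
  \<open>k \<otimes> a \<oplus> v\<close> determines \<open>k\<close> and \<open>v\<close>: two
  representations with different \<open>k\<close> could be solved for \<open>a\<close>, putting
  \<open>a\<close> into \<open>E\<close>. This is the induction step for counting a vector space by
  its dimension.\<close>

lemma (in ring) card_line_extension:
  assumes "subfield K R" "a \<in> carrier R" "a \<notin> E" "subgroup E (add_monoid R)"
    and smult: "\<And>k u. k \<in> K \<Longrightarrow> u \<in> E \<Longrightarrow> k \<otimes> u \<in> E"
  shows "card (line_extension K a E) = card K * card E"
proof -
  interpret K: subfield K R by fact
  have E: "E \<subseteq> carrier R"
    using add.subgroupE(1)[OF assms(4)] .
  have "inj_on (\<lambda>(k, v). k \<otimes> a \<oplus> v) (K \<times> E)"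
  proof (rule inj_onI, clarsimp)
    fix k v k' v'
    assume k: "k \<in> K" "k' \<in> K" and v: "v \<in> E" "v' \<in> E"
      and eq: "k \<otimes> a \<oplus> v = k' \<otimes> a \<oplus> v'"
    have c: "k \<in> carrier R" "k' \<in> carrier R" "v \<in> carrier R" "v' \<in> carrier R"
      using k v E K.subset by auto
    have "(k \<ominus> k') \<otimes> a = (k \<otimes> a \<oplus> v) \<ominus> v \<ominus> k' \<otimes> a"
      using c assms(2) by algebra
    also have "\<dots> = (k' \<otimes> a \<oplus> v') \<ominus> v \<ominus> k' \<otimes> a"
      by (simp only: eq)
    also have "\<dots> = v' \<ominus> v"
      using c assms(2) by algebra
    finally have d: "(k \<ominus> k') \<otimes> a = v' \<ominus> v" .
    have vE: "v' \<ominus> v \<in> E"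
      using v add.subgroupE(3,4)[OF assms(4)] by (simp add: a_minus_def)
    have kK: "k \<ominus> k' \<in> K"
      using k subringE(5,7)[OF subfieldE(1)[OF assms(1)]] by (simp add: a_minus_def)
    have "k = k'"
    proof (rule ccontr)
      assume "k \<noteq> k'"
      then have "k \<ominus> k' \<noteq> \<zero>"
        using c by simp
      then have "inv (k \<ominus> k') \<in> K" "inv (k \<ominus> k') \<otimes> (k \<ominus> k') = \<one>"
        using kK subfield_m_inv[OF assms(1)] by auto
      moreover from this have "a = inv (k \<ominus> k') \<otimes> ((k \<ominus> k') \<otimes> a)"
        using assms(2) c subsetD[OF K.subset] by (simp add: m_assoc[symmetric])
      ultimately show False
        using smult vE d assms(3) by metis
    qed
    moreover from this have "v = v'"
      using eq c assms(2) by simp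
    ultimately show "k = k' \<and> v = v'" by simp
  qed
  moreover have "line_extension K a E = (\<lambda>(k, v). k \<otimes> a \<oplus> v) ` (K \<times> E)"
    by (auto simp: line_extension_mem_iff) blast
  ultimately show ?thesis
    by (simp add: card_image card_cartesian_product)
qed

lemma (in ring) dimension_card:
  assumes K: "subfield K R" and "dimension n K E"
  shows "card E = card K ^ n"
  using assms(2)
proof (induction n arbitrary: E)
  case 0
  then show ?case using dimension_zero[OF K, of E] by simp
next
  case (Suc n)
  then obtain v E' where v: "v \<in> carrier R" "dimension n K E'" "v \<notin> E'" "E = line_extension K v E'"
    using dimension_backwards[OF K] by blast
  obtain Us where Us: "set Us \<subseteq> carrier R" "E' = Span K Us"
    using exists_base[OF K v(2)] by blast
  have "card E = card K * card E'"
    unfolding v(4) using Us Span_is_add_subgroup[OF K] Span_smult_closed[OF K] v(1,3)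
    by (intro card_line_extension[OF K]) auto
  with Suc.IH[OF v(2)] show ?case by simp
qed

section \<open>Binomial theorem and additivity of p-power maps\<close>

text \<open>Induction by Pascal's rule. Binomial coefficients act through \<open>add_pow\<close>,
  because the ring contains no natural numbers.\<close>

lemma (in cring) binomial_expansion:
  assumes [simp]: "x \<in> carrier R" "y \<in> carrier R"
  shows "(x \<oplus> y) [^] (n::nat) = (\<Oplus>k\<in>{..n}. add_pow R (n choose k) (x [^] k \<otimes> y [^] (n - k)))"
proof (induction n)
  case 0
  then show ?case by simp
next
  case (Suc n)
  let ?f = "\<lambda>n k. add_pow R (n choose k) (x [^] k \<otimes> y [^] (n - k))"
  let ?g = "\<lambda>k. add_pow R (n choose k) (x [^] k \<otimes> y [^] (Suc n - k))"
  have *: "add_pow R c (x [^] k \<otimes> w) \<otimes> x = add_pow R c (x [^] Suc k \<otimes> w)"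
    if "w \<in> carrier R" for c k :: nat and w
  proof -
    have "x [^] k \<otimes> w \<otimes> x = x [^] Suc k \<otimes> w"
      using that m_comm[of w x] by (simp add: m_assoc)
    then show ?thesis
      using that by (simp only: add_pow_ldistr assms m_closed nat_pow_closed)
  qed
  have x: "(x \<oplus> y) [^] n \<otimes> x = (\<Oplus>k\<in>{..n}. add_pow R (n choose k) (x [^] Suc k \<otimes> y [^] (n - k)))"
    unfolding Suc
    by (subst finsum_ldistr) (auto intro!: finsum_cong' simp: * simp del: nat_pow_Suc)
  have "(x \<oplus> y) [^] n \<otimes> y = (\<Oplus>k\<in>{..n}. ?g k)"
    unfolding Suc
    by (subst finsum_ldistr) (auto intro!: finsum_cong' simp: add_pow_ldistr m_assoc Suc_diff_le)
  \<comment> \<open>The term with index \<open>Suc n\<close> has coefficient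
    \<open>n choose Suc n = 0\<close>. Adding it lets the sum be shifted by one, which splits off
    \<open>y [^] Suc n\<close> and aligns the rest with the expansion of the product with
    \<open>x\<close>.\<close>
  also have "\<dots> = (\<Oplus>k\<in>{..Suc n}. ?g k)"
  proof -
    have "?g (Suc n) = \<zero>"
      by (simp add: binomial_eq_0 del: nat_pow_Suc)
    moreover have "(\<Oplus>k\<in>{..n}. ?g k) \<in> carrier R"
      by (rule finsum_closed) simp
    moreover have "(\<Oplus>k\<in>{..Suc n}. ?g k) = ?g (Suc n) \<oplus> (\<Oplus>k\<in>{..n}. ?g k)"
      by (rule finsum_Suc) simp
    ultimately show ?thesis
      by (simp only: l_zero)
  qed
  also have "\<dots> = (\<Oplus>k\<in>{..n}. ?g (Suc k)) \<oplus> ?g 0"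
    by (rule finsum_Suc2) simp
  also have "?g 0 = y [^] Suc n"
    by (simp del: nat_pow_Suc)
  finally have y: "(x \<oplus> y) [^] n \<otimes> y = (\<Oplus>k\<in>{..n}. ?g (Suc k)) \<oplus> y [^] Suc n" .
  have "(\<Oplus>k\<in>{..Suc n}. ?f (Suc n) k) = (\<Oplus>k\<in>{..n}. ?f (Suc n) (Suc k)) \<oplus> ?f (Suc n) 0"
    by (rule finsum_Suc2) simp
  also have "?f (Suc n) 0 = y [^] Suc n"
    by (simp del: nat_pow_Suc)
  also have "(\<Oplus>k\<in>{..n}. ?f (Suc n) (Suc k)) =
      (\<Oplus>k\<in>{..n}. add_pow R (n choose k) (x [^] Suc k \<otimes> y [^] (n - k)) \<oplus> ?g (Suc k))"
  proof (intro finsum_cong' refl)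
    fix k
    show "?f (Suc n) (Suc k) =
        add_pow R (n choose k) (x [^] Suc k \<otimes> y [^] (n - k)) \<oplus> ?g (Suc k)"
      using add.nat_pow_mult[of "x [^] Suc k \<otimes> y [^] (n - k)" "n choose k" "n choose Suc k"]
      by (simp del: nat_pow_Suc)
  qed simp
  also have "\<dots> = (x \<oplus> y) [^] n \<otimes> x \<oplus> (\<Oplus>k\<in>{..n}. ?g (Suc k))"
    unfolding x by (rule finsum_addf) auto
  finally have "(\<Oplus>k\<in>{..Suc n}. ?f (Suc n) k) =
    (x \<oplus> y) [^] n \<otimes> x \<oplus> ((\<Oplus>k\<in>{..n}. ?g (Suc k)) \<oplus> y [^] Suc n)"
    by (simp del: nat_pow_Suc add: a_assoc)
  also have "\<dots> = (x \<oplus> y) [^] Suc n"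
    unfolding y[symmetric] by (simp add: r_distr)
  finally show ?case by simp
qed

text \<open>All inner binomial coefficients of the exponent \<open>p\<close> are divisible by
  \<open>p\<close> and so act as zero; iterating the case \<open>k = 1\<close> gives the powers of
  \<open>p\<close>.\<close>

lemma (in cring) freshmans_dream:
  fixes p k :: nat
  assumes p: "Factorial_Ring.prime p" and char: "add_pow R p \<one> = \<zero>"
    and [simp]: "x \<in> carrier R" "y \<in> carrier R"
  shows "(x \<oplus> y) [^] p ^ k = x [^] p ^ k \<oplus> y [^] p ^ k"
proof -
  have p1: "p > 1" using p prime_gt_1_nat by blast
  have zero: "add_pow R m w = \<zero>" if "p dvd m" "w \<in> carrier R" for m :: nat and w
  proof -
    obtain l where "m = p * l" using \<open>p dvd m\<close> ..
    moreover have "add_pow R p w = add_pow R p \<one> \<otimes> w"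
      using that by (simp add: add_pow_ldistr)
    ultimately show ?thesis
      using char that by (simp add: add.nat_pow_pow[symmetric])
  qed
  have one: "(u \<oplus> v) [^] p = u [^] p \<oplus> v [^] p"
    if [simp]: "u \<in> carrier R" "v \<in> carrier R" for u v
  proof -
    \<comment> \<open>With this shape the index range splits into 0, the inner indices
      \<open>Suc k\<close> with \<open>k \<le> n\<close>, and \<open>p\<close>.\<close>
    obtain n where n: "p = Suc (Suc n)"
      using that[of "p - 2"] p1 by simp
    let ?f = "\<lambda>k. add_pow R (p choose k) (u [^] k \<otimes> v [^] (p - k))"
    have "(\<Oplus>k\<in>{..n}. ?f (Suc k)) = (\<Oplus>k\<in>{..n}. \<zero>)"
    proof (intro finsum_cong' refl)
      fix k assume "k \<in> {..n}"
      then have "p dvd p choose Suc k"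
        using p n by (intro dvd_choose_prime) auto
      then show "?f (Suc k) = \<zero>"
        by (rule zero) simp
    qed simp
    moreover have "(\<Oplus>k\<in>{..Suc n}. ?f k) = (\<Oplus>k\<in>{..n}. ?f (Suc k)) \<oplus> ?f 0"
      by (rule finsum_Suc2) simp
    ultimately have "(\<Oplus>k\<in>{..Suc n}. ?f k) = v [^] p"
      by simp
    moreover have "(\<Oplus>k\<in>{..p}. ?f k) = ?f p \<oplus> (\<Oplus>k\<in>{..Suc n}. ?f k)"
      unfolding n by (rule finsum_Suc) simp
    ultimately have "(\<Oplus>k\<in>{..p}. ?f k) = u [^] p \<oplus> v [^] p"
      by simp
    then show ?thesis
      by (simp add: binomial_expansion)
  qed
  show ?thesis
    by (induction k) (simp_all add: one nat_pow_pow[symmetric] mult.commute[of p])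
qed

section \<open>Finite field extensions of prime degree\<close>

locale finite_field_extension = field L for L (structure) +
  fixes F :: "'a set" and q r :: nat
  assumes F_subfield: "subfield F L" and primepow_q: "primepow q" and card_F: "card F = q"
    and prime_r: "Factorial_Ring.prime r" and dimension_L: "dimension r F (carrier L)"
begin

lemma q_gt_1: "q > 1"
  using primepow_q primepow_gt_Suc_0 by auto

lemma r_gt_1: "r > 1"
  using prime_r prime_gt_1_nat by blast

lemma F_subset: "F \<subseteq> carrier L"
  using subfieldE(3)[OF F_subfield] .

lemma card_L: "card (carrier L) = q ^ r"
  using dimension_card[OF F_subfield dimension_L] by (simp add: card_F)

lemma finite_L: "finite (carrier L)"
  using card_L q_gt_1 by (intro card_ge_0_finite) simp

lemma ext_degree_eq: "ext_degree L F = r"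
  using dimI[OF F_subfield dimension_L] by (simp add: ext_degree_def over_def)

text \<open>What must be found is the characteristic. The additive group has order
  \<open>p ^ (k * r)\<close>, so that multiple of \<open>\<one>\<close> vanishes; it equals the
  power \<open>k * r\<close> of \<open>add_pow L p \<one>\<close>, and a field has no nonzero
  nilpotents.\<close>

lemma pow_q_add:
  assumes [simp]: "x \<in> carrier L" "y \<in> carrier L"
  shows "(x \<oplus> y) [^] (q ^ t) = x [^] (q ^ t) \<oplus> y [^] (q ^ t)"
proof -
  obtain p k where p: "Factorial_Ring.prime p" and q: "q = p ^ k"
    using primepow_q by (auto simp: primepow_def)
  have pow: "add_pow L (p ^ n) \<one> = add_pow L p \<one> [^] n" for n :: nat
  proof (induction n)
    case (Suc n)
    have "add_pow L (p ^ Suc n) \<one> = add_pow L p (add_pow L (p ^ n) \<one>)"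
      by (simp add: add.nat_pow_pow mult.commute[of p])
    also have "\<dots> = add_pow L p \<one> [^] Suc n"
      by (simp add: Suc add_pow_rdistr)
    finally show ?case .
  qed simp
  have "add_pow L (order (add_monoid L)) \<one> = \<zero>"
    using add.pow_order_eq_1[of \<one>] by simp
  then have "add_pow L p \<one> [^] (k * r) = \<zero>"
    by (simp add: order_def card_L q pow power_mult[symmetric])
  moreover have "a = \<zero>" if "a [^] n = \<zero>" "a \<in> carrier L" for a and n :: nat
    using that by (induction n) (auto simp: integral_iff)
  ultimately have "add_pow L p \<one> = \<zero>"
    by simp
  then show ?thesis
    using freshmans_dream[OF p, of x y "k * t"] by (simp add: q power_mult)
qed

lemma pow_card: "x \<in> carrier L \<Longrightarrow> x [^] (q ^ r) = x"
proof (cases "x = \<zero>")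
  case True
  then show ?thesis using q_gt_1 by (simp add: nat_pow_zero)
next
  case False
  assume x: "x \<in> carrier L"
  interpret M: group "Multiplicative_Group.mult_of L" by (rule field_mult_group)
  have "x [^] (q ^ r - 1) = \<one>"
    using M.pow_order_eq_1[of x] x False order_mult_of[OF finite_L] card_L
    by (simp add: Multiplicative_Group.nat_pow_mult_of order_def)
  moreover have "q ^ r = Suc (q ^ r - 1)"
    using q_gt_1 by simp
  ultimately show ?thesis
    using x by (metis l_one nat_pow_Suc)
qed

text \<open>Apart from zero these are roots of unity of exponent \<open>n - 1\<close>. The bound
  serves twice: it identifies \<open>F\<close> as the fixed field of the Frobenius map, and it shows
  that no smaller Frobenius power is the identity on \<open>L\<close>.\<close>

lemma roots_of_pow_eq_self:
  assumes "n > 1"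
  shows "card {x \<in> carrier L. x [^] (n::nat) = x} \<le> n"
proof -
  have "{x \<in> carrier L. x [^] n = x} \<subseteq> insert \<zero> {x \<in> carrier L. x [^] (n - 1) = \<one>}"
  proof
    fix x assume "x \<in> {x \<in> carrier L. x [^] n = x}"
    then have x: "x \<in> carrier L" "x [^] n = x" by auto
    have "x [^] n = x [^] (n - 1) \<otimes> x"
      using \<open>n > 1\<close> by (metis Suc_diff_1 less_trans nat_pow_Suc zero_less_one)
    then have "(x [^] (n - 1) \<ominus> \<one>) \<otimes> x = \<zero>"
      using x by (simp add: a_minus_def l_distr l_minus r_neg)
    then show "x \<in> insert \<zero> {x \<in> carrier L. x [^] (n - 1) = \<one>}"
      using x by (auto simp: integral_iff)
  qed
  then have "card {x \<in> carrier L. x [^] n = x} \<le> card (insert \<zero> {x \<in> carrier L. x [^] (n - 1) = \<one>})"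
    using finite_L by (intro card_mono) auto
  also have "\<dots> \<le> Suc (card {x \<in> carrier L. x [^] (n - 1) = \<one>})"
    by (rule card_insert_le_m1) auto
  also have "\<dots> \<le> n"
    using num_roots_le_deg[OF finite_L, of "n - 1"] \<open>n > 1\<close> by simp
  finally show ?thesis .
qed

text \<open>Lagrange in the multiplicative group of \<open>F\<close> gives one inclusion; the
  right-hand set has at most \<open>q\<close> elements, so the inclusion is an equality.\<close>

lemma mem_F_iff: "x \<in> F \<longleftrightarrow> x \<in> carrier L \<and> x [^] q = x"
proof -
  have "F \<subseteq> {x \<in> carrier L. x [^] q = x}"
  proof safe
    fix x assume x: "x \<in> F"
    then show "x \<in> carrier L" using F_subset by auto
    interpret K: field "L\<lparr>carrier := F\<rparr>"
      using subfield_iff(2)[OF F_subfield] .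
    have fin: "finite (carrier (L\<lparr>carrier := F\<rparr>))"
      using F_subset finite_L finite_subset by auto
    interpret M: group "Multiplicative_Group.mult_of (L\<lparr>carrier := F\<rparr>)" by (rule K.field_mult_group)
    show "x [^] q = x"
    proof (cases "x = \<zero>")
      case True
      then show ?thesis using q_gt_1 by (simp add: nat_pow_zero)
    next
      case False
      then have "x [^] (q - 1) = \<one>"
        using M.pow_order_eq_1[of x] x K.order_mult_of[OF fin] card_F
        by (simp add: Multiplicative_Group.nat_pow_mult_of order_def nat_pow_def)
      moreover have "q = Suc (q - 1)"
        using q_gt_1 by simp
      ultimately show ?thesis
        using x F_subset by (metis l_one nat_pow_Suc subsetD)
    qed
  qed
  moreover have "finite {x \<in> carrier L. x [^] q = x}"
    using finite_L by simp
  ultimately have "F = {x \<in> carrier L. x [^] q = x}"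
    using roots_of_pow_eq_self[OF q_gt_1] card_F by (intro card_seteq) auto
  then show ?thesis by blast
qed

lemma pow_q_F: "c \<in> F \<Longrightarrow> c [^] (q ^ t) = c"
  by (induction t) (use mem_F_iff in \<open>auto simp: nat_pow_pow[symmetric] mult.commute[of q]\<close>)

lemma pow_q_mod:
  assumes "x \<in> carrier L"
  shows "x [^] (q ^ (t mod r)) = x [^] (q ^ t)"
proof -
  have "x [^] (q ^ (r * k + s)) = x [^] (q ^ s)" for k s
  proof (induction k)
    case (Suc k)
    have "q ^ (r * Suc k + s) = q ^ r * q ^ (r * k + s)"
      by (simp add: power_add)
    then show ?case
      using assms Suc by (simp add: nat_pow_pow[symmetric] pow_card)
  qed simp
  from this[of "t div r" "t mod r"] show ?thesis by simp
qed

lemma pow_q_bij: "bij_betw (\<lambda>x. x [^] (q ^ t)) (carrier L) (carrier L)"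
proof -
  have "inj_on (\<lambda>x. x [^] (q ^ t)) (carrier L)"
  \<comment> \<open>The inverse of the \<open>t\<close>-th Frobenius power is the
    \<open>t * (r - 1)\<close>-th, since the two exponents add up to \<open>t * r\<close>.\<close>
  proof (rule inj_on_inverseI[where g = "\<lambda>x. x [^] (q ^ (t * (r - 1)))"])
    fix x assume x: "x \<in> carrier L"
    have "t + t * (r - 1) = t * r"
      using r_gt_1 by (cases r) auto
    then have "(x [^] (q ^ t)) [^] (q ^ (t * (r - 1))) = x [^] (q ^ (t * r))"
      using x by (simp add: nat_pow_pow power_add[symmetric])
    also have "\<dots> = x"
      using pow_q_mod[OF x, of "t * r"] x by simp
    finally show "(x [^] (q ^ t)) [^] (q ^ (t * (r - 1))) = x" .
  qed
  then show ?thesis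
    using finite_L by (simp add: bij_betw_def endo_inj_surj image_subsetI)
qed

lemma pow_q_inj: "\<lbrakk>x \<in> carrier L; y \<in> carrier L; x [^] (q ^ t) = y [^] (q ^ t)\<rbrakk> \<Longrightarrow> x = y"
  using pow_q_bij[of t] by (auto simp: bij_betw_def inj_on_def)

lemma pow_q_ring_hom: "(\<lambda>x. x [^] (q ^ t)) \<in> ring_hom L L"
  by (rule ring_hom_memI) (simp_all add: nat_pow_distrib pow_q_add)

section \<open>The cyclic multiplicative group of \<open>L\<close> and a fixed generator\<close>

definition gen :: 'a
  where "gen = (SOME g. g \<in> carrier L - {\<zero>} \<and> carrier L - {\<zero>} = range (\<lambda>i::nat. g [^] i))"

lemma gen: "gen \<in> carrier L" "gen \<noteq> \<zero>" "carrier L - {\<zero>} = range (\<lambda>i::nat. gen [^] i)"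
proof -
  have "\<exists>g. g \<in> carrier L - {\<zero>} \<and> carrier L - {\<zero>} = range (\<lambda>i::nat. g [^] i)"
    using finite_field_mult_group_has_gen[OF finite_L] by (auto simp: full_SetCompr_eq)
  then have "gen \<in> carrier L - {\<zero>} \<and> carrier L - {\<zero>} = range (\<lambda>i::nat. gen [^] i)"
    unfolding gen_def by (rule someI_ex)
  then show "gen \<in> carrier L" "gen \<noteq> \<zero>" "carrier L - {\<zero>} = range (\<lambda>i::nat. gen [^] i)"
    by auto
qed

lemma gen_pow_eq_one_iff: "gen [^] (n::nat) = \<one> \<longleftrightarrow> q ^ r - 1 dvd n"
proof -
  interpret M: group "Multiplicative_Group.mult_of L" by (rule field_mult_group)
  have "M.ord gen = card (generate (Multiplicative_Group.mult_of L) {gen})"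
    by (rule M.generate_pow_card) (simp add: gen(1,2))
  also have "generate (Multiplicative_Group.mult_of L) {gen} = carrier (Multiplicative_Group.mult_of L)"
    using M.generate_pow_on_finite_carrier[OF finite_mult_of[OF finite_L], of gen] gen(1,2)
    by (simp add: Multiplicative_Group.nat_pow_mult_of full_SetCompr_eq gen(3)[symmetric])
  also have "card \<dots> = q ^ r - 1"
    using order_mult_of[OF finite_L] card_L by (simp add: order_def)
  finally show ?thesis
    using M.pow_eq_id[of gen n] gen(1,2) by (simp add: Multiplicative_Group.nat_pow_mult_of)
qed

text \<open>The Frobenius map has order exactly \<open>r\<close>. If two exponents below
  \<open>r\<close> gave the same conjugate of \<open>gen\<close>, their difference
  \<open>t - s\<close> would give a Frobenius power fixing \<open>gen\<close>, hence all of
  \<open>L\<close>, and \<open>X^(q^(t-s)) - X\<close> would have \<open>q ^ r\<close>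
  roots.\<close>

lemma pow_q_gen_inj:
  assumes "gen [^] (q ^ s) = gen [^] (q ^ t)"
  shows "[s = t] (mod r)"
proof -
  have *: "\<not> s < t" if eq: "gen [^] (q ^ s) = gen [^] (q ^ t)" and "t < r" for s t
  proof
    assume "s < t"
    then have "t = (t - s) + s" by simp
    then have "(gen [^] (q ^ (t - s))) [^] (q ^ s) = gen [^] (q ^ t)"
      using gen by (metis nat_pow_pow power_add)
    then have g: "gen [^] (q ^ (t - s)) = gen"
      using gen eq pow_q_inj by (metis nat_pow_closed)
    have "x [^] (q ^ (t - s)) = x" if x: "x \<in> carrier L" for x
    proof (cases "x = \<zero>")
      case True
      then show ?thesis using q_gt_1 by (simp add: nat_pow_zero)
    next
      case False
      then obtain i :: nat where "x = gen [^] i"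
        using gen(3) x by blast
      then show ?thesis
        using g gen(1) by (metis mult.commute nat_pow_pow)
    qed
    then have "{x \<in> carrier L. x [^] (q ^ (t - s)) = x} = carrier L"
      by blast
    then have "q ^ r \<le> q ^ (t - s)"
      using roots_of_pow_eq_self[of "q ^ (t - s)"] one_less_power[OF q_gt_1, of "t - s"] \<open>s < t\<close> card_L by simp
    then show False
      using \<open>s < t\<close> \<open>t < r\<close> power_le_imp_le_exp[OF q_gt_1] by fastforce
  qed
  have "gen [^] (q ^ (s mod r)) = gen [^] (q ^ (t mod r))"
    using assms gen by (simp add: pow_q_mod)
  then have "\<not> s mod r < t mod r" "\<not> t mod r < s mod r"
    using *[of "s mod r" "t mod r"] *[of "t mod r" "s mod r"] r_gt_1 by auto
  then show ?thesis
    by (simp add: cong_def)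
qed

section \<open>Automorphisms over \<open>F\<close> and eigenvectors of the Frobenius map\<close>

text \<open>The \<open>r\<close> distinct conjugates \<open>gen [^] (q ^ t)\<close> are roots of the
  minimal polynomial of \<open>gen\<close>, whose degree is at most \<open>r\<close>, so they are
  all its roots. Hence \<open>\<tau> gen\<close> is one of them, and \<open>\<tau>\<close> is
  determined by its value at \<open>gen\<close>. The form with \<open>ring_hom\<close> applies
  directly to the maps extracted from algebra isomorphisms.\<close>

lemma automorphism_eq_pow_q:
  assumes \<tau>: "\<tau> \<in> ring_hom L L" and fixes_F: "\<And>x. x \<in> F \<Longrightarrow> \<tau> x = x"
  obtains t where "t < r" "\<And>x. x \<in> carrier L \<Longrightarrow> \<tau> x = x [^] (q ^ t)"
proof -
  define p where "p = Irr F gen"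
  have alg: "(algebraic over F) gen"
    using finite_dimension_imp_algebraic[OF F_subfield carrier_is_subring finite_dimensionI[OF dimension_L]]
      gen by blast
  note p = IrrE[OF F_subfield gen(1) alg, folded p_def]
  have set_p: "set p \<subseteq> F"
    using p(1) by (auto simp: univ_poly_carrier[symmetric] polynomial_def)
  have p_L: "p \<in> carrier (poly_ring L)"
    using p(1) carrier_polynomial_shell[OF subfieldE(1)[OF F_subfield]] by blast
  have p_ne: "p \<noteq> []"
    using pirreducibleE(1)[OF subfieldE(1)[OF F_subfield] p(1,2)] .
  \<comment> \<open>The degree of \<open>p\<close> is bounded by counting: \<open>F(gen)\<close> has
    \<open>q ^ degree p\<close> elements and sits inside \<open>L\<close>.\<close>
  have "card (simple_extension F gen) = q ^ degree p"
    using dimension_card[OF F_subfield dimension_simple_extension[OF F_subfield gen(1) alg]]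
    by (simp add: p_def card_F)
  moreover have "simple_extension F gen \<subseteq> carrier L"
    using simple_extension_in_carrier[OF F_subset gen(1)] .
  ultimately have "q ^ degree p \<le> q ^ r"
    using card_mono[OF finite_L] card_L by metis
  then have deg: "degree p \<le> r"
    using power_le_imp_le_exp[OF q_gt_1] by blast
  \<comment> \<open>Stated for arbitrary \<open>\<rho>\<close>, since it is applied both to the
    Frobenius powers and to \<open>\<tau>\<close>.\<close>
  have root: "\<rho> gen \<in> set_mset (roots p)" if "\<rho> \<in> ring_hom L L" "\<And>x. x \<in> F \<Longrightarrow> \<rho> x = x" for \<rho>
  proof -
    interpret \<rho>: ring_hom_ring L L \<rho>
      using that(1) by (intro ring_hom_ringI2 ring_axioms)
    have "map \<rho> p = p"
      using that(2) set_p by (simp add: map_idI subset_iff)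
    then have "eval p (\<rho> gen) = \<zero>"
      using \<rho>.eval_hom'[OF gen(1), of p] set_p F_subset p(4) by auto
    then show ?thesis
      using p_ne gen(1) by (simp add: roots_mem_iff_is_root[OF p_L] is_root_def)
  qed
  have "inj_on (\<lambda>t. gen [^] (q ^ t)) {..<r}"
    using pow_q_gen_inj by (intro inj_onI) (metis cong_def lessThan_iff mod_less)
  then have "card ((\<lambda>t. gen [^] (q ^ t)) ` {..<r}) = r"
    by (simp add: card_image)
  moreover have "card (set_mset (roots p)) \<le> r"
    using size_roots_le_degree[OF p_L] deg size_mset_mono[OF mset_set_set_mset_msubset[of "roots p"]]
    by simp
  moreover have "(\<lambda>t. gen [^] (q ^ t)) ` {..<r} \<subseteq> set_mset (roots p)"
    using root[OF pow_q_ring_hom] by (auto simp: pow_q_F)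
  ultimately have "(\<lambda>t. gen [^] (q ^ t)) ` {..<r} = set_mset (roots p)"
    by (intro card_seteq) auto
  then obtain t where t: "t < r" "\<tau> gen = gen [^] (q ^ t)"
    using root[OF \<tau> fixes_F] by auto
  interpret \<tau>: ring_hom_ring L L \<tau>
    using \<tau> by (intro ring_hom_ringI2 ring_axioms)
  have "\<tau> x = x [^] (q ^ t)" if x: "x \<in> carrier L" for x
  proof (cases "x = \<zero>")
    case True
    then show ?thesis using q_gt_1 by (simp add: nat_pow_zero)
  next
    case False
    then obtain i :: nat where "x = gen [^] i"
      using gen(3) x by blast
    then show ?thesis
      using t(2) gen(1) by (simp add: \<tau>.hom_nat_pow nat_pow_pow mult.commute)
  qed
  with t(1) show ?thesis by (rule that)
qed

text \<open>Frobenius powers fix \<open>c\<close>, so iteration gives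
  \<open>a [^] (q ^ (s * u)) = c [^] u \<otimes> a\<close>. As \<open>r\<close> is prime,
  \<open>s\<close> is invertible modulo \<open>r\<close>, and \<open>u\<close> is taken to be its
  inverse. The last conclusion covers elements fixed by a Frobenius power.\<close>

lemma pow_q_eigenvector:
  assumes a: "a \<in> carrier L" and c: "c \<in> F" and eq: "a [^] (q ^ s) = c \<otimes> a"
    and "\<not> r dvd s"
  obtains d where "d \<in> F" "a [^] q = d \<otimes> a" "c = \<one> \<Longrightarrow> d = \<one>"
proof -
  have cL: "c \<in> carrier L" using c F_subset by auto
  have iter: "a [^] (q ^ (s * u)) = c [^] u \<otimes> a" for u
  proof (induction u)
    case (Suc u)
    have "a [^] (q ^ (s * Suc u)) = (a [^] (q ^ (s * u))) [^] (q ^ s)"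
      using a by (simp add: nat_pow_pow power_add[symmetric] add.commute)
    also have "\<dots> = (c [^] u) [^] (q ^ s) \<otimes> (c \<otimes> a)"
      using a cL by (simp add: Suc nat_pow_distrib eq)
    also have "(c [^] u) [^] (q ^ s) = (c [^] (q ^ s)) [^] u"
      using cL by (simp add: nat_pow_pow mult.commute)
    also have "\<dots> = c [^] u"
      using c by (simp add: pow_q_F)
    finally show ?case
      using a cL by (simp add: m_assoc)
  qed (use a in simp)
  have "coprime s r"
    using prime_r \<open>\<not> r dvd s\<close> by (simp add: coprime_commute prime_imp_coprime)
  then obtain u where u: "[s * u = 1] (mod r)"
    using cong_solve_coprime_nat by auto
  then have "(s * u) mod r = 1"
    using r_gt_1 by (simp add: cong_def)
  then have "a [^] q = c [^] u \<otimes> a"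
    using pow_q_mod[OF a, of "s * u"] iter[of u] by simp
  moreover have "c [^] u \<in> F"
    using c subring_props(1)[OF F_subfield] by (induction u) (auto intro: subringE[OF subfieldE(1)[OF F_subfield]])
  ultimately show ?thesis
    by (intro that[of "c [^] u"]) simp_all
qed

lemma F_closed:
  "\<zero> \<in> F" "\<one> \<in> F" "\<lbrakk>c \<in> F; d \<in> F\<rbrakk> \<Longrightarrow> c \<otimes> d \<in> F" "c \<in> F \<Longrightarrow> c [^] (n::nat) \<in> F"
proof -
  show "\<zero> \<in> F" "\<one> \<in> F" and mult: "\<And>c d. \<lbrakk>c \<in> F; d \<in> F\<rbrakk> \<Longrightarrow> c \<otimes> d \<in> F"
    using subringE[OF subfieldE(1)[OF F_subfield]] by auto
  then show "c \<in> F \<Longrightarrow> c [^] n \<in> F"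
    by (induction n) auto
qed

lemma F_inv: "\<lbrakk>c \<in> F; c \<noteq> \<zero>\<rbrakk> \<Longrightarrow> inv c \<in> F"
  using subfield_m_inv(1)[OF F_subfield, of c] by simp

lemma inv_nonzero: "\<lbrakk>c \<in> carrier L; c \<noteq> \<zero>\<rbrakk> \<Longrightarrow> inv c \<in> carrier L \<and> inv c \<noteq> \<zero> \<and> inv c \<otimes> c = \<one> \<and> c \<otimes> inv c = \<one>"
  using field_Units by (auto simp: Units_l_inv Units_r_inv)

lemma nat_pow_nonzero: "\<lbrakk>c \<in> carrier L; c \<noteq> \<zero>\<rbrakk> \<Longrightarrow> c [^] (n::nat) \<noteq> \<zero>"
  by (induction n) (auto simp: integral_iff)

lemma card_F_nonzero: "card (F - {\<zero>}) = q - 1"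
  using F_closed(1) finite_subset[OF F_subset finite_L] by (simp add: card_F)

section \<open>The norm as a power map\<close>

text \<open>This is \<open>(q ^ r - 1) / (q - 1)\<close>, the exponent for which
  \<open>x [^] Q\<close> is the norm of \<open>x\<close> from \<open>L\<close> to
  \<open>F\<close>.\<close>

definition Q :: nat where "Q = (\<Sum>s<r. q ^ s)"

lemma Q: "q ^ r - 1 = (q - 1) * Q"
proof -
  obtain p where p: "q = Suc p"
    using q_gt_1 by (cases q) auto
  have "q ^ n = Suc (p * (\<Sum>s<n. q ^ s))" for n
    by (induction n) (simp_all add: p algebra_simps)
  from this[of r] have "q ^ r - 1 = p * Q"
    unfolding Q_def by simp
  then show ?thesis
    using p by simp
qed

lemma gen_pow_cong:
  assumes "[i = j] (mod (q ^ r - 1))"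
  shows "gen [^] i = gen [^] j"
proof -
  have *: "gen [^] i = gen [^] (i mod (q ^ r - 1))" for i
  proof -
    have "gen [^] i = gen [^] ((q ^ r - 1) * (i div (q ^ r - 1))) \<otimes> gen [^] (i mod (q ^ r - 1))"
      using gen(1) by (simp only: nat_pow_mult mult_div_mod_eq)
    also have "gen [^] ((q ^ r - 1) * (i div (q ^ r - 1))) = \<one>"
      using gen_pow_eq_one_iff by simp
    finally show ?thesis using gen(1) by simp
  qed
  show ?thesis
    using assms *[of i] *[of j] by (simp add: cong_def)
qed

lemma nonzero_eq_gen_pow: "carrier L - {\<zero>} = (\<lambda>i. gen [^] i) ` {..<q ^ r - 1}"
proof -
  have "gen [^] i \<in> (\<lambda>i. gen [^] i) ` {..<q ^ r - 1}" for i :: nat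
  proof (rule image_eqI)
    show "gen [^] i = gen [^] (i mod (q ^ r - 1))"
      by (rule gen_pow_cong) (simp add: cong_def)
    show "i mod (q ^ r - 1) \<in> {..<q ^ r - 1}"
      using one_less_power[OF q_gt_1, of r] r_gt_1 by simp
  qed
  then show ?thesis
    unfolding gen(3) by auto
qed

lemma gen_pow_inj: "inj_on (\<lambda>i. gen [^] i) {..<q ^ r - 1}"
  by (rule eq_card_imp_inj_on)
    (use finite_L in \<open>simp_all only: nonzero_eq_gen_pow[symmetric] card_Diff_singleton zero_closed
      card_L card_lessThan finite_lessThan\<close>)

text \<open>The exponent is that of the norm written with the generator
  \<open>x \<mapsto> x^(q^j)\<close>. It is congruent to \<open>Q\<close> modulo
  \<open>q ^ r - 1\<close>, and an element \<open>gen [^] t\<close> of \<open>F\<close> has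
  \<open>Q\<close> dividing \<open>t\<close>, so \<open>gen [^] (t div Q)\<close> is a
  preimage.\<close>

lemma norm_surj:
  assumes c: "c \<in> F" "c \<noteq> \<zero>" and j: "\<not> r dvd j"
  obtains k where "k \<in> carrier L" "k \<noteq> \<zero>" "k [^] (\<Sum>s<r. q ^ (j * s)) = c"
proof -
  have cL: "c \<in> carrier L" using c F_subset by auto
  obtain t :: nat where t: "c = gen [^] t"
    using gen(3) c(2) cL by blast
  have "c [^] (q - 1) \<otimes> c = c"
    using mem_F_iff[of c] c(1) q_gt_1 cL nat_pow_Suc[of c "q - 1"] by simp
  then have "c [^] (q - 1) \<otimes> c = \<one> \<otimes> c"
    using cL by simp
  then have "c [^] (q - 1) = \<one>"
    using cL c(2) m_rcancel[of c "c [^] (q - 1)" \<one>] by simp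
  then have "q ^ r - 1 dvd t * (q - 1)"
    using t gen(1) gen_pow_eq_one_iff by (simp add: nat_pow_pow)
  then have "(q - 1) * Q dvd (q - 1) * t"
    by (simp only: Q mult.commute[of t])
  then have "Q dvd t"
    using q_gt_1 by simp
  then obtain u where u: "t = u * Q"
    by (metis dvdE mult.commute)
  have "coprime j r"
    using prime_imp_coprime[OF prime_r j] by (rule coprime_commute[THEN iffD1])
  \<comment> \<open>Multiplication by the unit \<open>j\<close> modulo \<open>r\<close> merely
    permutes the summands of \<open>Q\<close>.\<close>
  then have "inj_on (\<lambda>s. (j * s) mod r) {..<r}"
    by (intro inj_onI) (metis cong_def cong_mult_lcancel_nat lessThan_iff mod_less coprime_commute)
  then have "bij_betw (\<lambda>s. (j * s) mod r) {..<r} {..<r}"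
    using r_gt_1 by (simp add: bij_betw_def endo_inj_surj image_subsetI)
  then have "(\<Sum>s<r. q ^ ((j * s) mod r)) = Q"
    unfolding Q_def by (rule sum.reindex_bij_betw)
  \<comment> \<open>Exponents of \<open>q\<close> count only modulo \<open>r\<close>, because
    \<open>q ^ r\<close> is 1 modulo \<open>q ^ r - 1\<close>.\<close>
  moreover have "[q ^ s = q ^ (s mod r)] (mod (q ^ r - 1))" for s
  proof -
    have "[(q ^ r) ^ (s div r) * q ^ (s mod r) = 1 ^ (s div r) * q ^ (s mod r)] (mod (q ^ r - 1))"
      using q_gt_1 by (intro cong_mult cong_pow cong_refl) (simp add: cong_altdef_nat)
    then show ?thesis
      by (simp add: power_mult[symmetric] power_add[symmetric])
  qed
  then have "[(\<Sum>s<r. q ^ (j * s)) = (\<Sum>s<r. q ^ ((j * s) mod r))] (mod (q ^ r - 1))"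
    by (intro cong_sum)
  ultimately have "gen [^] (u * (\<Sum>s<r. q ^ (j * s))) = c"
    unfolding t u by (intro gen_pow_cong cong_mult cong_refl) simp
  then show ?thesis
    using gen nat_pow_nonzero by (intro that[of "gen [^] u"]) (auto simp: nat_pow_pow)
qed

end

section \<open>Counting the orbits\<close>

text \<open>\<open>S\<close> is a disjoint union of whole classes, all of size \<open>k\<close>. It
  is applied separately to the small and the large classes.\<close>

lemma card_quotient_uniform:
  assumes "equiv A R" "finite A" "S \<subseteq> A"
    and "\<And>a. a \<in> S \<Longrightarrow> R `` {a} \<subseteq> S" "\<And>a. a \<in> S \<Longrightarrow> card (R `` {a}) = k"
  shows "card S = k * card (S // R)"
proof -
  have S: "\<Union> (S // R) = S"
  proof
    show "\<Union> (S // R) \<subseteq> S"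
      using assms(4) unfolding quotient_def by blast
    show "S \<subseteq> \<Union> (S // R)"
      using equiv_class_self[OF assms(1)] assms(3) unfolding quotient_def by blast
  qed
  have "finite S"
    using assms(2,3) finite_subset by blast
  moreover from this have "finite (S // R)"
    by (simp add: quotient_def)
  moreover have "C \<inter> D = {}" if "C \<in> S // R" "D \<in> S // R" "C \<noteq> D" for C D
    using that assms(1,3) quotient_disj[of A R C D] by (auto simp: quotient_def)
  ultimately have "k * card (S // R) = card (\<Union> (S // R))"
    using assms(5) S by (intro card_partition) (auto simp: quotient_def simp del: Union_iff)
  then show ?thesis by (simp add: S)
qed

context finite_field_extension
begin

text \<open>The eigenvectors, outside \<open>F\<close>, of the \<open>F\<close>-linear Frobenius
  map; these are the elements whose class is smaller than \<open>r * (q - 1)\<close>.\<close>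

definition eigen :: "'a set"
  where "eigen = {a \<in> carrier L - F. \<exists>d\<in>F. a [^] q = d \<otimes> a}"

text \<open>Every summand of \<open>Q\<close> is 1 modulo \<open>q - 1\<close>, so \<open>Q\<close>
  is congruent to \<open>r\<close>.\<close>

lemma gcd_Q: "gcd Q (q - 1) = gcd r (q - 1)"
proof -
  have "[Q = (\<Sum>s<r. 1 ^ s)] (mod (q - 1))"
    unfolding Q_def using q_gt_1 by (intro cong_sum cong_pow) (simp add: cong_altdef_nat)
  then have "[Q = r] (mod (q - 1))" by simp
  then show ?thesis
    using cong_gcd_eq by blast
qed

text \<open>The only candidate for \<open>d\<close> is \<open>a [^] (q - 1)\<close>, and a nonzero
  element lies in \<open>F\<close> exactly when its power \<open>q - 1\<close> is 1.\<close>

lemma pow_eq_mult_F_iff: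
  assumes a: "a \<in> carrier L" "a \<noteq> \<zero>"
  shows "(\<exists>d\<in>F. a [^] q = d \<otimes> a) \<longleftrightarrow> a [^] ((q - 1) * (q - 1)) = \<one>"
proof -
  have q: "a [^] q = a [^] (q - 1) \<otimes> a"
    using q_gt_1 nat_pow_Suc[of a "q - 1"] by simp
  have "(\<exists>d\<in>F. a [^] q = d \<otimes> a) \<longleftrightarrow> a [^] (q - 1) \<in> F"
    unfolding q using a F_subset by (auto simp: m_rcancel)
  also have "\<dots> \<longleftrightarrow> (a [^] (q - 1)) [^] (q - 1) \<otimes> a [^] (q - 1) = \<one> \<otimes> a [^] (q - 1)"
    using q_gt_1 nat_pow_Suc[of "a [^] (q - 1)" "q - 1"] a by (simp add: mem_F_iff)
  also have "\<dots> \<longleftrightarrow> (a [^] (q - 1)) [^] (q - 1) = \<one>"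
    using a nat_pow_nonzero by (intro m_rcancel) auto
  finally show ?thesis
    using a by (simp add: nat_pow_pow)
qed

text \<open>Put \<open>Q = g * D\<close> and \<open>q - 1 = g * m\<close> with \<open>D\<close> and
  \<open>m\<close> coprime. Then \<open>gen [^] i\<close> satisfies the power condition exactly when
  \<open>D\<close> divides \<open>i\<close>, which leaves \<open>(q - 1) * g\<close> elements; the
  \<open>q - 1\<close> nonzero elements of \<open>F\<close> are among them and are removed.\<close>

lemma card_eigen: "card eigen = (q - 1) * (gcd r (q - 1) - 1)"
proof -
  define g where "g = gcd r (q - 1)"
  define S where "S = {a \<in> carrier L - {\<zero>}. a [^] ((q - 1) * (q - 1)) = \<one>}"
  obtain D where D: "Q = g * D"
    using gcd_Q g_def by (metis dvdE gcd_dvd1)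
  obtain m where m: "q - 1 = g * m"
    using g_def by (metis dvdE gcd_dvd2)
  have "g > 0" using r_gt_1 by (simp add: g_def)
  have "m > 0" using m q_gt_1 by (cases m) auto
  have "Q > 0" using Q one_less_power[OF q_gt_1, of r] r_gt_1 by (cases "Q = 0") auto
  then have "D > 0" using D by (cases D) auto
  have "coprime D m"
    using gcd_Q D m \<open>g > 0\<close> unfolding g_def[symmetric]
    by (metis coprime_iff_gcd_eq_1 gcd_mult_distrib_nat mult_cancel1 mult.right_neutral neq0_conv)
  have M: "q ^ r - 1 = ((q - 1) * g) * D"
    using Q D by simp
  have iff: "gen [^] i \<in> S \<longleftrightarrow> D dvd i" for i
  proof -
    have "gen [^] i \<in> S \<longleftrightarrow> q ^ r - 1 dvd i * ((q - 1) * (q - 1))"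
      using gen nat_pow_nonzero by (simp add: S_def nat_pow_pow gen_pow_eq_one_iff)
    also have "\<dots> \<longleftrightarrow> (q - 1) * Q dvd (q - 1) * (i * (q - 1))"
      by (simp only: Q mult_ac)
    also have "\<dots> \<longleftrightarrow> g * D dvd g * (i * m)"
      unfolding D m using \<open>m > 0\<close> by (simp add: mult.left_commute[of i g])
    also have "\<dots> \<longleftrightarrow> D dvd i"
      using \<open>g > 0\<close> \<open>coprime D m\<close> by (simp add: coprime_dvd_mult_left_iff)
    finally show ?thesis .
  qed
  \<comment> \<open>By \<open>M\<close>, the multiples of \<open>D\<close> below
    \<open>q ^ r - 1\<close> are the \<open>D * u\<close> with
    \<open>u < (q - 1) * g\<close>.\<close>
  have "S = (\<lambda>u. gen [^] (D * u)) ` {..<(q - 1) * g}"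
  proof (intro equalityI subsetI)
    fix a assume a: "a \<in> S"
    then obtain i where i: "i < q ^ r - 1" "a = gen [^] i"
      using nonzero_eq_gen_pow by (auto simp: S_def)
    then obtain u where u: "i = D * u"
      using a iff by auto
    then show "a \<in> (\<lambda>u. gen [^] (D * u)) ` {..<(q - 1) * g}"
      using i M \<open>D > 0\<close> by (auto simp: mult.commute[of _ D])
  qed (auto simp: iff)
  moreover have "inj_on (\<lambda>u. gen [^] (D * u)) {..<(q - 1) * g}"
  proof (rule inj_onI)
    fix u v assume uv: "u \<in> {..<(q - 1) * g}" "v \<in> {..<(q - 1) * g}" "gen [^] (D * u) = gen [^] (D * v)"
    then have "D * u < q ^ r - 1" "D * v < q ^ r - 1"
      using M \<open>D > 0\<close> by (simp_all add: mult.commute[of _ D])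
    then have "D * u = D * v"
      using inj_onD[OF gen_pow_inj uv(3)] by simp
    then show "u = v" using \<open>D > 0\<close> by simp
  qed
  ultimately have S: "card S = (q - 1) * g"
    by (simp add: card_image)
  have "c \<in> S" if c: "c \<in> F - {\<zero>}" for c
  proof -
    have cL: "c \<in> carrier L" "c \<noteq> \<zero>"
      using c F_subset by auto
    have "c [^] q = \<one> \<otimes> c"
      using c mem_F_iff by simp
    then have "c [^] ((q - 1) * (q - 1)) = \<one>"
      using F_closed(2) pow_eq_mult_F_iff[OF cL] by blast
    then show ?thesis
      using cL by (simp add: S_def)
  qed
  then have sub: "F - {\<zero>} \<subseteq> S" by blast
  have "a \<in> eigen \<longleftrightarrow> a \<in> S - (F - {\<zero>})" for a
  proof (cases "a \<in> carrier L - {\<zero>}")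
    case True
    then show ?thesis
      using pow_eq_mult_F_iff[of a] unfolding eigen_def S_def by blast
  next
    case False
    then show ?thesis
      using F_closed(1) unfolding eigen_def S_def by blast
  qed
  then have "eigen = S - (F - {\<zero>})" by blast
  then have "card eigen = (q - 1) * g - (q - 1)"
    using S sub finite_subset[OF F_subset finite_L] by (simp add: card_Diff_subset card_F_nonzero)
  then show ?thesis
    by (simp add: g_def diff_mult_distrib2)
qed

lemma pow_q_eigen:
  assumes "a \<in> carrier L" "d \<in> F" "a [^] q = d \<otimes> a"
  shows "a [^] (q ^ t) = d [^] t \<otimes> a"
proof (induction t)
  case (Suc t)
  have d: "d \<in> carrier L" using assms F_subset by auto
  have "a [^] (q ^ Suc t) = (a [^] (q ^ t)) [^] q"
    using assms by (simp add: nat_pow_pow mult.commute)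
  also have "\<dots> = (d [^] t) [^] q \<otimes> (d \<otimes> a)"
    using assms d by (simp add: Suc nat_pow_distrib)
  also have "(d [^] t) [^] q = d [^] t"
    using F_closed(4)[OF assms(2)] mem_F_iff by blast
  finally show ?case
    using assms d by (simp add: m_assoc)
qed (use assms in simp)

text \<open>Classes inside \<open>eigen\<close> have \<open>q - 1\<close> elements, all others
  \<open>r * (q - 1)\<close>, so both kinds can be counted by division. Keeping the gcd in the
  formula treats the two cases of the theorem at once.\<close>

lemma card_quotient:
  assumes E: "equiv (carrier L - F) E"
    and E_def: "\<And>a. a \<in> carrier L - F \<Longrightarrow>
      E `` {a} = (\<lambda>(t, c). c \<otimes> a [^] (q ^ t)) ` ({..<r} \<times> (F - {\<zero>}))"
  shows "real (card ((carrier L - F) // E)) =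
    real (gcd r (q - 1) - 1) +
    (real q ^ r - real q - (real q - 1) * real (gcd r (q - 1) - 1)) / (real r * (real q - 1))"
proof -
  let ?X = "carrier L - F"
  have nz: "a \<noteq> \<zero>" if "a \<in> ?X" for a
    using that F_closed(1) by auto
  have FL: "c \<in> carrier L" if "c \<in> F" for c
    using that F_subset by auto
  have B_class: "E `` {a} = (\<lambda>c. c \<otimes> a) ` (F - {\<zero>})" if B: "a \<in> eigen" for a
  proof -
    obtain d where a: "a \<in> ?X" and d: "d \<in> F" "a [^] q = d \<otimes> a"
      using B unfolding eigen_def by blast
    \<comment> \<open>The Frobenius power contributes only a scalar \<open>d [^] t\<close>; since
      \<open>d\<close> is nonzero, it is absorbed into \<open>c\<close>.\<close>
    have "d \<noteq> \<zero>"
      using d nat_pow_nonzero[of a q] a nz by auto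
    then have "(\<lambda>(t, c). c \<otimes> a [^] (q ^ t)) ` ({..<r} \<times> (F - {\<zero>})) \<subseteq> (\<lambda>c. c \<otimes> a) ` (F - {\<zero>})"
      using a d FL nat_pow_nonzero F_closed
      by (auto simp: pow_q_eigen[OF _ d] m_assoc[symmetric] integral_iff intro!: imageI)
    moreover have "(\<lambda>c. c \<otimes> a) ` (F - {\<zero>}) \<subseteq> (\<lambda>(t, c). c \<otimes> a [^] (q ^ t)) ` ({..<r} \<times> (F - {\<zero>}))"
    proof (rule image_subsetI)
      fix c assume "c \<in> F - {\<zero>}"
      then show "c \<otimes> a \<in> (\<lambda>(t, c). c \<otimes> a [^] (q ^ t)) ` ({..<r} \<times> (F - {\<zero>}))"
        using a r_gt_1 by (intro image_eqI[of _ _ "(0, c)"]) auto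
    qed
    ultimately show ?thesis
      using E_def[OF a] by auto
  qed
  have B_sub: "E `` {a} \<subseteq> eigen" if B: "a \<in> eigen" for a
  proof
    fix b assume b: "b \<in> E `` {a}"
    then have "b \<in> ?X"
      using equiv_type[OF E] by auto
    obtain c where c: "c \<in> F - {\<zero>}" "b = c \<otimes> a"
      using b B_class[OF B] by auto
    obtain d where a: "a \<in> ?X" and d: "d \<in> F" "a [^] q = d \<otimes> a"
      using B unfolding eigen_def by blast
    have "b [^] q = c \<otimes> (d \<otimes> a)"
      using c d a FL mem_F_iff[of c] by (simp add: nat_pow_distrib)
    also have "\<dots> = d \<otimes> b"
      using c d a FL by (simp add: m_lcomm)
    finally show "b \<in> eigen"
      using \<open>b \<in> ?X\<close> d by (auto simp: eigen_def)
  qed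
  have B_card: "card (E `` {a}) = q - 1" if "a \<in> eigen" for a
  proof -
    have "a \<in> ?X" using that by (simp add: eigen_def)
    then have "inj_on (\<lambda>c. c \<otimes> a) (F - {\<zero>})"
      using nz FL by (auto intro!: inj_onI simp: m_rcancel)
    then show ?thesis
      by (simp add: B_class[OF that] card_image card_F_nonzero)
  qed
  have sub: "eigen \<subseteq> ?X"
    by (auto simp: eigen_def)
  have fin: "finite ?X"
    using finite_L by simp
  have B: "card eigen = (q - 1) * card (eigen // E)"
    by (rule card_quotient_uniform[OF E fin sub B_sub B_card])
  have G_sub: "E `` {a} \<subseteq> ?X - eigen" if "a \<in> ?X - eigen" for a
  proof
    fix b assume b: "b \<in> E `` {a}"
    then have "(a, b) \<in> E" by simp
    moreover from this have "(b, a) \<in> E"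
      using E by (meson equivE symD)
    ultimately have "b \<in> ?X" "a \<in> E `` {b}"
      using equiv_type[OF E] by auto
    then show "b \<in> ?X - eigen"
      using B_sub[of b] that by blast
  qed
  have G_card: "card (E `` {a}) = r * (q - 1)" if a: "a \<in> ?X - eigen" for a
  proof -
    \<comment> \<open>A coincidence of two orbit points with \<open>s < t\<close> would make
      \<open>a\<close> an eigenvector of the Frobenius power \<open>t - s\<close>, hence an element
      of \<open>eigen\<close>.\<close>
    have not: "\<not> s < t" if "s < r" "t < r" "c \<in> F - {\<zero>}" "d \<in> F - {\<zero>}"
      and eq: "c \<otimes> a [^] (q ^ s) = d \<otimes> a [^] (q ^ t)" for s t c d
    proof
      assume "s < t"
      define e where "e = inv d \<otimes> c"
      have e: "e \<in> F"
        using that F_inv F_closed by (auto simp: e_def)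
      have "(a [^] (q ^ (t - s))) [^] (q ^ s) = a [^] (q ^ t)"
        using a \<open>s < t\<close> by (simp add: nat_pow_pow power_add[symmetric])
      also have "\<dots> = inv d \<otimes> (d \<otimes> a [^] (q ^ t))"
        using that(4) FL a inv_nonzero[of d] by (simp add: m_assoc[symmetric])
      also have "\<dots> = e \<otimes> a [^] (q ^ s)"
        using that(3,4) FL a inv_nonzero[of d] by (simp add: eq[symmetric] e_def m_assoc)
      \<comment> \<open>As \<open>e\<close> is fixed by the Frobenius map, both sides become
        \<open>q ^ s\<close>-th powers and injectivity cancels the exponent.\<close>
      also have "\<dots> = (e \<otimes> a) [^] (q ^ s)"
        using e FL a by (simp add: nat_pow_distrib pow_q_F)
      finally have "a [^] (q ^ (t - s)) = e \<otimes> a"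
        using pow_q_inj e FL a by simp
      moreover have "\<not> r dvd t - s"
        using \<open>s < t\<close> \<open>t < r\<close> by (auto dest: dvd_imp_le)
      ultimately obtain d' where "d' \<in> F" "a [^] q = d' \<otimes> a"
        using pow_q_eigenvector e a by (metis DiffD1)
      then show False
        using a by (auto simp: eigen_def)
    qed
    have "inj_on (\<lambda>(t, c). c \<otimes> a [^] (q ^ t)) ({..<r} \<times> (F - {\<zero>}))"
    proof (rule inj_onI)
      fix x y
      assume "x \<in> {..<r} \<times> (F - {\<zero>})" "y \<in> {..<r} \<times> (F - {\<zero>})"
        and xy: "(\<lambda>(t, c). c \<otimes> a [^] (q ^ t)) x = (\<lambda>(t, c). c \<otimes> a [^] (q ^ t)) y"
      then obtain s c t d where x: "x = (s, c)" and y: "y = (t, d)"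
        and *: "s < r" "c \<in> F - {\<zero>}" "t < r" "d \<in> F - {\<zero>}"
        by auto
      have eq: "c \<otimes> a [^] (q ^ s) = d \<otimes> a [^] (q ^ t)"
        using xy by (simp add: x y)
      have "s = t"
        using not[OF *(1,3,2,4) eq] not[OF *(3,1,4,2) eq[symmetric]] by simp
      moreover have "a [^] (q ^ t) \<noteq> \<zero>"
        using a nz nat_pow_nonzero by simp
      ultimately show "x = y"
        using eq * a FL by (simp add: x y m_rcancel)
    qed
    then show ?thesis
      using a E_def[of a] by (simp add: card_image card_cartesian_product card_F_nonzero)
  qed
  have G: "card (?X - eigen) = (r * (q - 1)) * card ((?X - eigen) // E)"
    by (rule card_quotient_uniform[OF E fin _ G_sub G_card]) auto
  have "?X // E = eigen // E \<union> (?X - eigen) // E"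
    using sub by (auto simp: quotient_def)
  moreover have "eigen // E \<inter> (?X - eigen) // E = {}"
  proof -
    have "C \<subseteq> eigen" if "C \<in> eigen // E" for C
      using that B_sub by (auto simp: quotient_def)
    moreover have "C \<subseteq> ?X - eigen \<and> C \<noteq> {}" if "C \<in> (?X - eigen) // E" for C
      using that G_sub equiv_class_self[OF E] by (fastforce simp: quotient_def)
    ultimately show ?thesis by blast
  qed
  moreover have "finite (eigen // E)" "finite ((?X - eigen) // E)"
    using fin sub finite_subset by (auto simp: quotient_def)
  ultimately have "card (?X // E) = card (eigen // E) + card ((?X - eigen) // E)"
    by (simp add: card_Un_disjoint)
  moreover have "card (eigen // E) = gcd r (q - 1) - 1"
    using B card_eigen q_gt_1 by simp
  moreover have "real (card ((?X - eigen) // E)) =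
      (real q ^ r - real q - (real q - 1) * real (gcd r (q - 1) - 1)) / (real r * (real q - 1))"
  proof -
    have "card ?X = q ^ r - q"
      using finite_L finite_subset[OF F_subset] F_subset by (simp add: card_Diff_subset card_L card_F)
    then have "card (?X - eigen) + card eigen = q ^ r - q"
      using card_Diff_subset[OF finite_subset[OF sub fin] sub] card_mono[OF fin sub] by simp
    moreover have "q ^ r \<ge> q"
      using self_le_power[of q r] q_gt_1 r_gt_1 by simp
    ultimately have "real (card (?X - eigen)) + real (card eigen) = real q ^ r - real q"
      by (metis of_nat_add of_nat_diff of_nat_power)
    moreover have "real (card eigen) = (real q - 1) * real (gcd r (q - 1) - 1)"
      using q_gt_1 by (simp add: card_eigen of_nat_diff)
    moreover have "real (card (?X - eigen)) = real r * (real q - 1) * real (card ((?X - eigen) // E))"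
      using q_gt_1 by (simp add: G of_nat_diff)
    ultimately show ?thesis
      using q_gt_1 r_gt_1 by (simp add: field_simps)
  qed
  ultimately show ?thesis by simp
qed

end

section \<open>Isomorphisms of nonassociative cyclic algebras\<close>

definition left_nucleus :: "('a, 'm) monoid_scheme \<Rightarrow> 'a set"
  where "left_nucleus A = {x \<in> carrier A. \<forall>y\<in>carrier A. \<forall>w\<in>carrier A.
    (x \<otimes>\<^bsub>A\<^esub> y) \<otimes>\<^bsub>A\<^esub> w = x \<otimes>\<^bsub>A\<^esub> (y \<otimes>\<^bsub>A\<^esub> w)}"

text \<open>The left nucleus is defined by multiplication alone. Closure of \<open>A\<close> is what
  allows injectivity of \<open>h\<close> on the carrier to be applied to products.\<close>

lemma left_nucleus_iso:
  assumes bij: "bij_betw h (carrier A) (carrier B)"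
    and hom: "\<And>x y. \<lbrakk>x \<in> carrier A; y \<in> carrier A\<rbrakk> \<Longrightarrow> h (x \<otimes>\<^bsub>A\<^esub> y) = h x \<otimes>\<^bsub>B\<^esub> h y"
    and closed: "\<And>x y. \<lbrakk>x \<in> carrier A; y \<in> carrier A\<rbrakk> \<Longrightarrow> x \<otimes>\<^bsub>A\<^esub> y \<in> carrier A"
  shows "h ` left_nucleus A = left_nucleus B"
proof -
  have B: "carrier B = h ` carrier A"
    using bij by (simp add: bij_betw_def)
  have iff: "h x \<in> left_nucleus B \<longleftrightarrow> x \<in> left_nucleus A" if x: "x \<in> carrier A" for x
  proof -
    have "(h x \<otimes>\<^bsub>B\<^esub> h y) \<otimes>\<^bsub>B\<^esub> h w = h x \<otimes>\<^bsub>B\<^esub> (h y \<otimes>\<^bsub>B\<^esub> h w) \<longleftrightarrow>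
        (x \<otimes>\<^bsub>A\<^esub> y) \<otimes>\<^bsub>A\<^esub> w = x \<otimes>\<^bsub>A\<^esub> (y \<otimes>\<^bsub>A\<^esub> w)"
      if "y \<in> carrier A" "w \<in> carrier A" for y w
      using x that bij_betw_imp_inj_on[OF bij]
      by (simp add: hom[symmetric] closed inj_on_eq_iff)
    then show ?thesis
      using x by (auto simp: left_nucleus_def B)
  qed
  show ?thesis
  proof (intro equalityI subsetI)
    fix y assume "y \<in> h ` left_nucleus A"
    then show "y \<in> left_nucleus B"
      using iff by (auto simp: left_nucleus_def[of A])
  next
    fix y assume y: "y \<in> left_nucleus B"
    then obtain x where "x \<in> carrier A" "y = h x"
      by (auto simp: left_nucleus_def B)
    then show "y \<in> h ` left_nucleus A"
      using y iff by blast
  qed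
qed

section \<open>Coefficient arithmetic in the cyclic algebra and its left nucleus\<close>

text \<open>Isolates what the isomorphism argument uses about \<open>\<sigma>\<close>. For finite
  fields, \<open>\<sigma>_pow_moves\<close> is the assumption that rests on the primality of the
  degree.\<close>

locale nonassoc_cyclic = field L for L (structure) +
  fixes F :: "'a set" and \<sigma> :: "'a \<Rightarrow> 'a" and n :: nat
  assumes F_subset: "F \<subseteq> carrier L"
    and \<sigma>_hom: "\<sigma> \<in> ring_hom L L"
    and degree: "ext_degree L F = n" and n_gt_1: "n > 1"
    and \<sigma>_pow_n: "x \<in> carrier L \<Longrightarrow> (\<sigma> ^^ n) x = x"
    and \<sigma>_pow_moves: "\<lbrakk>a \<in> carrier L - F; 0 < i; i < n\<rbrakk> \<Longrightarrow> (\<sigma> ^^ i) a \<noteq> a"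
begin

abbreviation A :: "'a \<Rightarrow> ('a, nat \<Rightarrow> 'a) module"
  where "A \<equiv> nonassoc_cyclic_algebra L F \<sigma>"

abbreviation mon :: "'a \<Rightarrow> nat \<Rightarrow> nat \<Rightarrow> 'a"
  where "mon \<equiv> cyc_monom L n"

lemma \<sigma>_pow_hom: "\<sigma> ^^ i \<in> ring_hom L L"
proof (induction i)
  case 0
  show ?case by (auto intro: ring_hom_memI)
next
  case (Suc i)
  then show ?case
    using ring_hom_trans[OF Suc \<sigma>_hom] by (simp only: funpow.simps)
qed

lemma \<sigma>_pow [simp]:
  "x \<in> carrier L \<Longrightarrow> (\<sigma> ^^ i) x \<in> carrier L"
  "\<lbrakk>x \<in> carrier L; y \<in> carrier L\<rbrakk> \<Longrightarrow> (\<sigma> ^^ i) (x \<otimes> y) = (\<sigma> ^^ i) x \<otimes> (\<sigma> ^^ i) y"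
  "(\<sigma> ^^ i) \<one> = \<one>" "(\<sigma> ^^ i) \<zero> = \<zero>"
  using ring_hom_closed[OF \<sigma>_pow_hom[of i]] ring_hom_mult[OF \<sigma>_pow_hom[of i]]
    ring_hom_one[OF \<sigma>_pow_hom[of i]] ring_hom_zero[OF \<sigma>_pow_hom[of i] ring_axioms ring_axioms]
  by blast+

lemmas \<sigma>_simps [simp] = \<sigma>_pow[where i = 1, simplified]

lemma \<sigma>_pow_inj: "\<lbrakk>x \<in> carrier L; y \<in> carrier L; (\<sigma> ^^ i) x = (\<sigma> ^^ i) y; i \<le> n\<rbrakk> \<Longrightarrow> x = y"
  by (metis \<sigma>_pow_n comp_apply funpow_add le_add_diff_inverse2)

text \<open>Cancelling one \<open>\<sigma>\<close> reduces this to
  \<open>\<sigma>_pow_moves\<close>. It later forces the image of \<open>z\<close> to be a multiple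
  of \<open>z\<close>.\<close>

lemma \<sigma>_pow_eq_\<sigma>:
  assumes "a \<in> carrier L - F" "i < n" "(\<sigma> ^^ i) a = \<sigma> a"
  shows "i = 1"
proof (rule ccontr)
  assume "i \<noteq> 1"
  then consider "i = 0" | j where "i = Suc j" "0 < j"
    by (cases i) auto
  then show False
  proof cases
    case 1
    then show ?thesis
      using \<sigma>_pow_moves[of a 1] assms n_gt_1 by simp
  next
    case 2
    then have "(\<sigma> ^^ j) a = a"
      using \<sigma>_pow_inj[of "(\<sigma> ^^ j) a" a 1] assms n_gt_1 by simp
    then show ?thesis
      using \<sigma>_pow_moves[of a j] assms 2 by simp
  qed
qed

lemma carrier_A: "carrier (A a) = {..<n} \<rightarrow>\<^sub>E carrier L"
  by (simp add: nonassoc_cyclic_algebra_def degree Let_def)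

lemma coeff_closed [simp]: "\<lbrakk>x \<in> carrier (A a); i < n\<rbrakk> \<Longrightarrow> x i \<in> carrier L"
  by (auto simp: carrier_A)

lemma carrier_A_eqI:
  "\<lbrakk>x \<in> carrier (A a); y \<in> carrier (A b); \<And>i. i < n \<Longrightarrow> x i = y i\<rbrakk> \<Longrightarrow> x = y"
  by (auto simp: carrier_A intro: PiE_ext)

lemma monom_closed [simp]: "l \<in> carrier L \<Longrightarrow> mon l i \<in> carrier (A a)"
  by (auto simp: carrier_A cyc_monom_def)

lemma monom_coeff: "k < n \<Longrightarrow> mon l i k = (if k = i then l else \<zero>)"
  by (simp add: cyc_monom_def)

lemma A_closed [simp]:
  assumes "a \<in> carrier L"
  shows "\<lbrakk>x \<in> carrier (A a); y \<in> carrier (A a)\<rbrakk> \<Longrightarrow> x \<otimes>\<^bsub>A a\<^esub> y \<in> carrier (A a)"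
    "\<lbrakk>x \<in> carrier (A a); y \<in> carrier (A a)\<rbrakk> \<Longrightarrow> x \<oplus>\<^bsub>A a\<^esub> y \<in> carrier (A a)"
    "\<lbrakk>c \<in> carrier L; x \<in> carrier (A a)\<rbrakk> \<Longrightarrow> c \<odot>\<^bsub>A a\<^esub> x \<in> carrier (A a)"
  using nonassoc_cyclic_algebra_closed[OF ring_axioms _ assms, where \<sigma> = \<sigma> and F = F] by auto

lemma A_one: "\<one>\<^bsub>A a\<^esub> = mon \<one> 0"
  by (simp add: nonassoc_cyclic_algebra_def degree Let_def)

lemma A_add_coeff: "k < n \<Longrightarrow> (x \<oplus>\<^bsub>A a\<^esub> y) k = x k \<oplus> y k"
  by (simp add: nonassoc_cyclic_algebra_def degree Let_def)

lemma A_smult_coeff: "k < n \<Longrightarrow> (c \<odot>\<^bsub>A a\<^esub> x) k = c \<otimes> x k"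
  by (simp add: nonassoc_cyclic_algebra_def degree Let_def)

lemma A_mult_coeff: "k < n \<Longrightarrow> (x \<otimes>\<^bsub>A a\<^esub> y) k =
  (\<Oplus>i\<in>{..<n}. \<Oplus>j\<in>{..<n}. cyc_monom_mult L n \<sigma> a (x i) i (y j) j k)"
  by (simp add: nonassoc_cyclic_algebra_def degree Let_def)

lemma monom_mult_closed [simp]:
  "\<lbrakk>a \<in> carrier L; l \<in> carrier L; m \<in> carrier L; k < n\<rbrakk> \<Longrightarrow> cyc_monom_mult L n \<sigma> a l i m j k \<in> carrier L"
  using cyc_monom_mult_closed[OF ring_axioms, of \<sigma>] by auto

lemma monom_mult:
  assumes "a \<in> carrier L" "l \<in> carrier L" "m \<in> carrier L" "i < n" "j < n"
  shows "mon l i \<otimes>\<^bsub>A a\<^esub> mon m j =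
    (if i + j < n then mon (l \<otimes> (\<sigma> ^^ i) m) (i + j) else mon (l \<otimes> (\<sigma> ^^ i) m \<otimes> a) (i + j - n))"
  using nonassoc_cyclic_algebra_monom_mult[OF ring_axioms \<sigma>_hom assms(1-3) degree[symmetric] assms(4,5)]
  by (simp add: cyc_monom_mult_def)

lemma finsum_delta2:
  assumes "R \<in> carrier L" "i0 < n" "j0 < n"
    and f: "\<And>i j. \<lbrakk>i < n; j < n\<rbrakk> \<Longrightarrow> f i j = (if i = i0 \<and> j = j0 then R else \<zero>)"
  shows "(\<Oplus>i\<in>{..<n}. \<Oplus>j\<in>{..<n}. f i j) = R"
proof -
  have inner: "(\<Oplus>j\<in>{..<n}. f i j) = (if i0 = i then R else \<zero>)" if "i < n" for i
  proof -
    have "(\<Oplus>j\<in>{..<n}. f i j) = (\<Oplus>j\<in>{..<n}. if j0 = j then (if i0 = i then R else \<zero>) else \<zero>)"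
      using assms(1) that by (intro finsum_cong') (auto simp: f)
    also have "\<dots> = (if i0 = i then R else \<zero>)"
      by (rule finsum_singleton[of j0 "{..<n}" "\<lambda>_. if i0 = i then R else \<zero>"]) (use assms in auto)
    finally show ?thesis .
  qed
  have "(\<Oplus>i\<in>{..<n}. \<Oplus>j\<in>{..<n}. f i j) = (\<Oplus>i\<in>{..<n}. if i0 = i then R else \<zero>)"
    using assms(1) by (intro finsum_cong') (auto simp: inner)
  also have "\<dots> = R"
    by (rule finsum_singleton[of i0 "{..<n}" "\<lambda>_. R"]) (use assms in auto)
  finally show ?thesis .
qed

lemma mult_monom_coeff:
  assumes a: "a \<in> carrier L" and x: "x \<in> carrier (A a)" and m: "m \<in> carrier L" and "j < n" "k < n"
  shows "(x \<otimes>\<^bsub>A a\<^esub> mon m j) k =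
    (if j \<le> k then x (k - j) \<otimes> (\<sigma> ^^ (k - j)) m else x (k + n - j) \<otimes> (\<sigma> ^^ (k + n - j)) m \<otimes> a)"
    (is "_ = ?R")
proof -
  \<comment> \<open>The only exponent with \<open>i0 + j\<close> congruent to \<open>k\<close>
    modulo \<open>n\<close>; the second case is the wrap-around, which brings in the factor
    \<open>a\<close>.\<close>
  define i0 where "i0 = (if j \<le> k then k - j else k + n - j)"
  have i0: "i0 < n" using \<open>j < n\<close> \<open>k < n\<close> by (auto simp: i0_def)
  show ?thesis
    unfolding A_mult_coeff[OF \<open>k < n\<close>]
  proof (rule finsum_delta2[OF _ i0 \<open>j < n\<close>])
    show "?R \<in> carrier L"
      using assms by auto
    fix i j' assume "i < n" "j' < n"
    then show "cyc_monom_mult L n \<sigma> a (x i) i (mon m j j') j' k =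
        (if i = i0 \<and> j' = j then ?R else \<zero>)"
      using assms by (auto simp: cyc_monom_mult_def cyc_monom_def i0_def)
  qed
qed

lemma monom_0_mult:
  assumes a: "a \<in> carrier L" and x: "x \<in> carrier (A a)" and l: "l \<in> carrier L"
  shows "mon l 0 \<otimes>\<^bsub>A a\<^esub> x = l \<odot>\<^bsub>A a\<^esub> x"
proof (rule carrier_A_eqI[of _ a _ a])
  fix k assume "k < n"
  have "(mon l 0 \<otimes>\<^bsub>A a\<^esub> x) k = l \<otimes> x k"
    unfolding A_mult_coeff[OF \<open>k < n\<close>]
  proof (rule finsum_delta2[of _ 0 k])
    fix i j assume "i < n" "j < n"
    then show "cyc_monom_mult L n \<sigma> a (mon l 0 i) i (x j) j k =
        (if i = 0 \<and> j = k then l \<otimes> x k else \<zero>)"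
      using assms \<open>k < n\<close> by (auto simp: cyc_monom_mult_def cyc_monom_def)
  qed (use assms \<open>k < n\<close> in auto)
  then show "(mon l 0 \<otimes>\<^bsub>A a\<^esub> x) k = (l \<odot>\<^bsub>A a\<^esub> x) k"
    by (simp add: A_smult_coeff \<open>k < n\<close>)
qed (use assms in auto)

text \<open>The scalar stands leftmost in every monomial product, so it can be pulled out of the
  sums. With \<open>monom_0_mult\<close> this places \<open>L\<close> in the left nucleus.\<close>

lemma smult_mult_assoc:
  assumes a: "a \<in> carrier L" and x: "x \<in> carrier (A a)" and y: "y \<in> carrier (A a)" and l: "l \<in> carrier L"
  shows "(l \<odot>\<^bsub>A a\<^esub> x) \<otimes>\<^bsub>A a\<^esub> y = l \<odot>\<^bsub>A a\<^esub> (x \<otimes>\<^bsub>A a\<^esub> y)"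
proof (rule carrier_A_eqI[of _ a _ a])
  fix k assume k: "k < n"
  have "((l \<odot>\<^bsub>A a\<^esub> x) \<otimes>\<^bsub>A a\<^esub> y) k =
      (\<Oplus>i\<in>{..<n}. \<Oplus>j\<in>{..<n}. l \<otimes> cyc_monom_mult L n \<sigma> a (x i) i (y j) j k)"
    unfolding A_mult_coeff[OF k] using assms k
    by (intro finsum_cong' refl) (auto simp: A_smult_coeff cyc_monom_mult_def cyc_monom_def m_assoc)
  also have "\<dots> = (\<Oplus>i\<in>{..<n}. l \<otimes> (\<Oplus>j\<in>{..<n}. cyc_monom_mult L n \<sigma> a (x i) i (y j) j k))"
    using assms k by (intro finsum_cong' refl finsum_rdistr[symmetric]) auto
  also have "\<dots> = l \<otimes> (\<Oplus>i\<in>{..<n}. \<Oplus>j\<in>{..<n}. cyc_monom_mult L n \<sigma> a (x i) i (y j) j k)"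
    using assms k by (intro finsum_rdistr[symmetric]) auto
  finally show "((l \<odot>\<^bsub>A a\<^esub> x) \<otimes>\<^bsub>A a\<^esub> y) k = (l \<odot>\<^bsub>A a\<^esub> (x \<otimes>\<^bsub>A a\<^esub> y)) k"
    by (simp add: A_smult_coeff A_mult_coeff k)
qed (use assms in auto)

lemma left_nucleus_A:
  assumes a: "a \<in> carrier L - F"
  shows "left_nucleus (A a) = (\<lambda>l. mon l 0) ` carrier L"
proof (intro equalityI subsetI)
  fix x assume "x \<in> (\<lambda>l. mon l 0) ` carrier L"
  then show "x \<in> left_nucleus (A a)"
    using a by (auto simp: left_nucleus_def monom_0_mult smult_mult_assoc)
next
  fix x assume "x \<in> left_nucleus (A a)"
  then have x: "x \<in> carrier (A a)"
    and assoc: "\<And>y w. \<lbrakk>y \<in> carrier (A a); w \<in> carrier (A a)\<rbrakk> \<Longrightarrow>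
      (x \<otimes>\<^bsub>A a\<^esub> y) \<otimes>\<^bsub>A a\<^esub> w = x \<otimes>\<^bsub>A a\<^esub> (y \<otimes>\<^bsub>A a\<^esub> w)"
    by (auto simp: left_nucleus_def)
  have aL: "a \<in> carrier L" using a by simp
  \<comment> \<open>Associativity of \<open>x z z\<^bsup>n-1\<^esup>\<close> forces \<open>x\<^sub>k a = x\<^sub>k \<sigma>\<^sup>k(a)\<close>.\<close>
  have "mon \<one> 1 \<otimes>\<^bsub>A a\<^esub> mon \<one> (n - 1) = mon a 0"
    using n_gt_1 aL by (simp add: monom_mult)
  then have *: "(x \<otimes>\<^bsub>A a\<^esub> mon \<one> 1) \<otimes>\<^bsub>A a\<^esub> mon \<one> (n - 1) = x \<otimes>\<^bsub>A a\<^esub> mon a 0"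
    using assoc[of "mon \<one> 1" "mon \<one> (n - 1)"] by simp
  have xk: "x k = \<zero>" if "0 < k" "k < n" for k
  proof -
    have "((x \<otimes>\<^bsub>A a\<^esub> mon \<one> 1) \<otimes>\<^bsub>A a\<^esub> mon \<one> (n - 1)) k = x k \<otimes> a"
    \<comment> \<open>The factor \<open>a\<close> comes from exactly one of the two products: from
      the one with \<open>z\<close> if \<open>k = n - 1\<close>, otherwise from the one with
      \<open>z^(n-1)\<close>.\<close>
    proof (cases "k = n - 1")
      case True
      then show ?thesis
        using n_gt_1 aL x by (simp add: mult_monom_coeff)
    next
      case False
      then have "k + n - (n - 1) = Suc k" "Suc k < n" "\<not> n - Suc 0 \<le> k"
        using that by auto
      then show ?thesis
        using n_gt_1 aL x that False by (simp add: mult_monom_coeff)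
    qed
    moreover have "(x \<otimes>\<^bsub>A a\<^esub> mon a 0) k = x k \<otimes> (\<sigma> ^^ k) a"
      using aL x that by (simp add: mult_monom_coeff)
    ultimately have "x k \<otimes> a = x k \<otimes> (\<sigma> ^^ k) a"
      using * by simp
    then show ?thesis
      using \<sigma>_pow_moves[OF a that] aL x that by (metis coeff_closed m_lcancel \<sigma>_pow(1))
  qed
  have "x = mon (x 0) 0"
    by (rule carrier_A_eqI[OF x monom_closed[where a = a]])
      (use x xk n_gt_1 in \<open>auto simp: monom_coeff\<close>)
  then show "x \<in> (\<lambda>l. mon l 0) ` carrier L"
    using x n_gt_1 by (intro image_eqI[of _ _ "x 0"]) auto
qed

section \<open>Norms and isomorphisms\<close>

text \<open>The partial norm \<open>k \<sigma>(k) ... \<sigma>^(i-1)(k)\<close>: for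
  \<open>i < n\<close> the coefficient obtained by multiplying \<open>k z\<close> on the left
  \<open>i\<close> times, and for \<open>i = n\<close> the norm of \<open>k\<close>.\<close>

primrec cyc_norm :: "'a \<Rightarrow> nat \<Rightarrow> 'a"
  where "cyc_norm k 0 = \<one>"
  | "cyc_norm k (Suc i) = k \<otimes> \<sigma> (cyc_norm k i)"

lemma norm_closed [simp]: "k \<in> carrier L \<Longrightarrow> cyc_norm k i \<in> carrier L"
  by (induction i) auto

text \<open>The cocycle rule, which makes \<open>x z^i \<mapsto> \<tau>(x) N_i(k) z^i\<close>
  multiplicative, with \<open>N_i(k)\<close> for \<open>cyc_norm k i\<close>.\<close>

lemma cyc_norm_add:
  "k \<in> carrier L \<Longrightarrow> cyc_norm k (i + j) = cyc_norm k i \<otimes> (\<sigma> ^^ i) (cyc_norm k j)"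
  by (induction i) (auto simp: m_assoc)

lemma cyc_norm_nonzero:
  assumes "k \<in> carrier L" "k \<noteq> \<zero>"
  shows "cyc_norm k i \<noteq> \<zero>"
proof (induction i)
  case (Suc i)
  then have "\<sigma> (cyc_norm k i) \<noteq> \<zero>"
    using \<sigma>_pow_inj[of "cyc_norm k i" \<zero> 1] n_gt_1 assms by auto
  then show ?case
    using assms by (simp add: integral_iff)
qed simp

text \<open>The restriction of \<open>h\<close> to the left nuclei is \<open>\<tau>\<close>, and
  \<open>k\<close> is read off from the image of \<open>z\<close>. The hypothesis
  \<open>comm\<close> expresses that the Galois group is abelian.\<close>

lemma iso_imp_norm_eq:
  assumes a: "a \<in> carrier L - F" and b: "b \<in> carrier L - F"
    and h: "h \<in> algebra_iso F (A a) (A b)"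
    and comm: "\<And>\<tau> x. \<lbrakk>\<tau> \<in> ring_hom L L; \<And>c. c \<in> F \<Longrightarrow> \<tau> c = c; x \<in> carrier L\<rbrakk> \<Longrightarrow> \<tau> (\<sigma> x) = \<sigma> (\<tau> x)"
  obtains \<tau> k where "\<tau> \<in> ring_hom L L" "\<And>c. c \<in> F \<Longrightarrow> \<tau> c = c"
    "k \<in> carrier L" "k \<noteq> \<zero>" "\<tau> a = cyc_norm k n \<otimes> b"
proof -
  have aL: "a \<in> carrier L" and bL: "b \<in> carrier L" using a b by auto
  have bij: "bij_betw h (carrier (A a)) (carrier (A b))"
    and hom: "h \<in> ring_hom (A a) (A b)"
    and lin: "\<And>c x. c \<in> F \<Longrightarrow> x \<in> carrier (A a) \<Longrightarrow> h (c \<odot>\<^bsub>A a\<^esub> x) = c \<odot>\<^bsub>A b\<^esub> h x"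
    using h by (auto simp: algebra_iso_def ring_iso_def)
  note h_mult = ring_hom_mult[OF hom]
  have "h ` left_nucleus (A a) = left_nucleus (A b)"
    using bij h_mult aL by (intro left_nucleus_iso) auto
  then have img: "(\<lambda>l. h (mon l 0)) ` carrier L = (\<lambda>l. mon l 0) ` carrier L"
    unfolding left_nucleus_A[OF a] left_nucleus_A[OF b] image_image .
  define \<tau> where "\<tau> l = h (mon l 0) 0" for l
  have \<tau>: "h (mon l 0) = mon (\<tau> l) 0" and \<tau>_closed: "\<tau> l \<in> carrier L" if l: "l \<in> carrier L" for l
  proof -
    obtain m where "m \<in> carrier L" "h (mon l 0) = mon m 0"
      using imageI[OF l, of "\<lambda>l. h (mon l 0)"] unfolding img by blast
    then show "h (mon l 0) = mon (\<tau> l) 0" "\<tau> l \<in> carrier L"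
      using n_gt_1 by (auto simp: \<tau>_def monom_coeff)
  qed
  have monom_eq: "l = m" if "mon l i = mon m i" "i < n" for l m i
    using fun_cong[OF that(1), of i] that(2) by (simp add: monom_coeff)
  have \<tau>_hom: "\<tau> \<in> ring_hom L L"
  proof (rule ring_hom_memI)
    fix x y assume xy: "x \<in> carrier L" "y \<in> carrier L"
    show "\<tau> x \<in> carrier L" using \<tau>_closed xy by simp
    have "mon (\<tau> (x \<otimes> y)) 0 = h (mon x 0 \<otimes>\<^bsub>A a\<^esub> mon y 0)"
      using xy aL n_gt_1 by (simp add: monom_mult \<tau>)
    also have "\<dots> = mon (\<tau> x \<otimes> \<tau> y) 0"
      using xy bL n_gt_1 by (simp add: h_mult[of _ "mon y 0"] \<tau> \<tau>_closed monom_mult)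
    finally show "\<tau> (x \<otimes> y) = \<tau> x \<otimes> \<tau> y"
      using monom_eq n_gt_1 by simp
    have add: "mon u 0 \<oplus>\<^bsub>A c\<^esub> mon v 0 = mon (u \<oplus> v) 0"
      if "u \<in> carrier L" "v \<in> carrier L" "c \<in> carrier L" for u v c
      by (rule carrier_A_eqI[of _ c _ c]) (use that in \<open>auto simp: A_add_coeff monom_coeff\<close>)
    have "mon (\<tau> (x \<oplus> y)) 0 = h (mon x 0 \<oplus>\<^bsub>A a\<^esub> mon y 0)"
      using xy aL by (simp add: add \<tau>)
    also have "\<dots> = mon (\<tau> x \<oplus> \<tau> y) 0"
      using xy bL by (simp add: ring_hom_add[OF hom] \<tau> \<tau>_closed add)
    finally show "\<tau> (x \<oplus> y) = \<tau> x \<oplus> \<tau> y"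
      using monom_eq n_gt_1 by simp
  next
    have "mon (\<tau> \<one>) 0 = mon \<one> 0"
      using ring_hom_one[OF hom] by (simp add: A_one \<tau>)
    then show "\<tau> \<one> = \<one>"
      using monom_eq n_gt_1 by simp
  qed
  have \<tau>_fix: "\<tau> c = c" if c: "c \<in> F" for c
  proof -
    have cL: "c \<in> carrier L" using c F_subset by auto
    have smult: "c \<odot>\<^bsub>A d\<^esub> mon \<one> 0 = mon c 0" if "d \<in> carrier L" for d
      by (rule carrier_A_eqI[of _ d _ d]) (use cL that in \<open>auto simp: A_smult_coeff monom_coeff\<close>)
    have "mon (\<tau> c) 0 = mon c 0"
      using lin[OF c, of "mon \<one> 0"] ring_hom_one[OF hom] aL bL cL by (simp add: A_one smult \<tau>)
    then show ?thesis
      using monom_eq n_gt_1 by simp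
  qed
  note comm\<tau> = comm[OF \<tau>_hom \<tau>_fix]
  define y where "y = h (mon \<one> 1)"
  have y: "y \<in> carrier (A b)"
    unfolding y_def using bij by (simp add: bij_betw_apply)
  have y_coeff: "y k = \<zero>" if k: "k < n" "k \<noteq> 1" for k
  proof (rule ccontr)
    assume nz: "y k \<noteq> \<zero>"
    \<comment> \<open>Apply \<open>h\<close> to \<open>z l = \<sigma>(l) z\<close> and compare
      coefficients at \<open>z^k\<close>. Taking for \<open>l\<close> the preimage of
      \<open>a\<close> under \<open>\<tau>\<close> then contradicts
      \<open>k \<noteq> 1\<close>.\<close>
    have "(\<sigma> ^^ k) (\<tau> l) = \<sigma> (\<tau> l)" if l: "l \<in> carrier L" for l
    proof -
      have "mon \<one> 1 \<otimes>\<^bsub>A a\<^esub> mon l 0 = mon (\<sigma> l) 0 \<otimes>\<^bsub>A a\<^esub> mon \<one> 1"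
        using l aL n_gt_1 by (simp add: monom_mult)
      then have "y \<otimes>\<^bsub>A b\<^esub> mon (\<tau> l) 0 = mon (\<tau> (\<sigma> l)) 0 \<otimes>\<^bsub>A b\<^esub> y"
        using h_mult[of "mon \<one> 1" "mon l 0"] h_mult[of "mon (\<sigma> l) 0" "mon \<one> 1"] l
        by (simp add: \<tau> y_def)
      then have "(y \<otimes>\<^bsub>A b\<^esub> mon (\<tau> l) 0) k = (mon (\<tau> (\<sigma> l)) 0 \<otimes>\<^bsub>A b\<^esub> y) k"
        by (rule fun_cong)
      then have "y k \<otimes> (\<sigma> ^^ k) (\<tau> l) = \<sigma> (\<tau> l) \<otimes> y k"
        using k l y bL by (simp add: mult_monom_coeff monom_0_mult A_smult_coeff \<tau>_closed comm\<tau>)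
      then have "y k \<otimes> (\<sigma> ^^ k) (\<tau> l) = y k \<otimes> \<sigma> (\<tau> l)"
        using l y k by (simp add: m_comm \<tau>_closed)
      then show ?thesis
        using nz l y k by (simp add: m_lcancel \<tau>_closed)
    qed
    moreover obtain l where "l \<in> carrier L" "\<tau> l = a"
    proof -
      have "mon a 0 \<in> (\<lambda>l. h (mon l 0)) ` carrier L"
        unfolding img using aL by blast
      then obtain l where "l \<in> carrier L" "mon a 0 = mon (\<tau> l) 0"
        using \<tau> by auto
      then show ?thesis
        using that monom_eq n_gt_1 by (metis less_trans zero_less_one)
    qed
    ultimately have "(\<sigma> ^^ k) a = \<sigma> a" by blast
    then show False
      using \<sigma>_pow_eq_\<sigma>[OF a k(1)] k(2) by simp
  qed
  define k where "k = y 1"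
  have k: "k \<in> carrier L"
    using y n_gt_1 by (simp add: k_def)
  have hz: "h (mon \<one> 1) = mon k 1"
    unfolding y_def[symmetric]
    by (rule carrier_A_eqI[OF y monom_closed[where a = b]]) (use k y_coeff in \<open>auto simp: monom_coeff k_def\<close>)
  \<comment> \<open>Otherwise \<open>h\<close> would take the same value at \<open>z\<close> and at
    zero, the monomials \<open>mon \<zero> 1\<close> and \<open>mon \<zero> 0\<close> both being the
    zero vector.\<close>
  have "k \<noteq> \<zero>"
  proof
    assume "k = \<zero>"
    moreover have "\<tau> \<zero> = \<zero>"
      using ring_hom_zero[OF \<tau>_hom ring_axioms ring_axioms] .
    moreover have "mon \<zero> 1 = mon \<zero> 0"
      by (simp add: cyc_monom_def)
    ultimately have "h (mon \<one> 1) = h (mon \<zero> 0)"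
      using hz by (simp add: \<tau>)
    then have "mon \<one> 1 = mon \<zero> 0"
      using bij_betw_imp_inj_on[OF bij] by (simp add: inj_on_eq_iff)
    then have "mon \<one> 1 1 = mon \<zero> 0 1" by simp
    then show False
      using n_gt_1 by (simp add: monom_coeff)
  qed
  have step: "h (mon \<one> i) = mon (cyc_norm k i) i" if "i < n" for i
    using that
  proof (induction i)
    case 0
    then show ?case
      using ring_hom_one[OF hom] by (simp add: A_one)
  next
    case (Suc i)
    have "mon \<one> (Suc i) = mon \<one> 1 \<otimes>\<^bsub>A a\<^esub> mon \<one> i"
      using Suc.prems aL by (simp add: monom_mult)
    then have "h (mon \<one> (Suc i)) = mon k 1 \<otimes>\<^bsub>A b\<^esub> mon (cyc_norm k i) i"
      using Suc by (simp add: h_mult[of _ "mon \<one> i"] hz[simplified])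
    then show ?case
      using Suc.prems bL k by (simp add: monom_mult)
  qed
  \<comment> \<open>With \<open>n' = n - 1\<close>, the product of \<open>z\<close> and
    \<open>z^n'\<close> is the first to wrap around, and it yields \<open>a\<close>.\<close>
  obtain n' where n': "Suc n' = n" and "n' < n"
    using n_gt_1 by (cases n) auto
  have "mon a 0 = mon \<one> 1 \<otimes>\<^bsub>A a\<^esub> mon \<one> n'"
    using n_gt_1 \<open>n' < n\<close> aL by (simp add: monom_mult n')
  then have "h (mon a 0) = mon k 1 \<otimes>\<^bsub>A b\<^esub> mon (cyc_norm k n') n'"
    using step[OF \<open>n' < n\<close>] by (simp add: h_mult[of _ "mon \<one> n'"] hz[simplified])
  also have "\<dots> = mon (cyc_norm k n \<otimes> b) 0"
    using n_gt_1 \<open>n' < n\<close> bL k cyc_norm.simps(2)[of k n'] by (simp add: monom_mult n')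
  finally have "\<tau> a = cyc_norm k n \<otimes> b"
    using aL \<tau> monom_eq n_gt_1 by (metis less_trans zero_less_one)
  then show ?thesis
    using that \<tau>_hom \<tau>_fix k \<open>k \<noteq> \<zero>\<close> by blast
qed

text \<open>The map is forced by \<open>z \<mapsto> k z\<close> and \<open>\<tau>\<close> on
  \<open>L\<close>. Multiplicativity is checked on monomials: the cocycle rule settles the case
  without wrap-around, and the relation between \<open>\<tau> a\<close> and \<open>b\<close> settles
  the other.\<close>

lemma norm_eq_imp_iso:
  assumes aL: "a \<in> carrier L" and bL: "b \<in> carrier L"
    and \<tau>: "\<tau> \<in> ring_hom L L" "bij_betw \<tau> (carrier L) (carrier L)" "\<And>c. c \<in> F \<Longrightarrow> \<tau> c = c"
    and comm: "\<And>x. x \<in> carrier L \<Longrightarrow> \<tau> (\<sigma> x) = \<sigma> (\<tau> x)"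
    and k: "k \<in> carrier L" "k \<noteq> \<zero>" and eq: "\<tau> a = cyc_norm k n \<otimes> b"
  shows "(\<lambda>x. \<lambda>i\<in>{..<n}. \<tau> (x i) \<otimes> cyc_norm k i) \<in> algebra_iso F (A a) (A b)" (is "?h \<in> _")
proof -
  note [simp] = ring_hom_closed[OF \<tau>(1)] ring_hom_mult[OF \<tau>(1)] ring_hom_add[OF \<tau>(1)]
    ring_hom_one[OF \<tau>(1)] ring_hom_zero[OF \<tau>(1) ring_axioms ring_axioms]
  note norm0 = cyc_norm_nonzero[OF k]
  have comm_pow: "\<tau> ((\<sigma> ^^ i) x) = (\<sigma> ^^ i) (\<tau> x)" if "x \<in> carrier L" for i x
    using that by (induction i) (auto simp: comm)
  have \<tau>_sum: "\<tau> (\<Oplus>i\<in>{..<n}. f i) = (\<Oplus>i\<in>{..<n}. \<tau> (f i))" if "f \<in> {..<n} \<rightarrow> carrier L" for f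
  proof -
    interpret T: ring_hom_cring L L \<tau>
      using \<tau>(1) by unfold_locales
    show ?thesis
      using T.hom_finsum[OF that] by (simp add: comp_def)
  qed
  have h_closed: "?h x \<in> carrier (A b)" if "x \<in> carrier (A a)" for x
    using that k by (auto simp: carrier_A PiE_iff)
  have mono: "\<tau> (cyc_monom_mult L n \<sigma> a l i m j u) \<otimes> cyc_norm k u =
      cyc_monom_mult L n \<sigma> b (\<tau> l \<otimes> cyc_norm k i) i (\<tau> m \<otimes> cyc_norm k j) j u"
    if [simp]: "l \<in> carrier L" "m \<in> carrier L" and ij: "i < n" "j < n" and u: "u < n" for l m i j u
  proof (cases "i + j < n")
    case True
    then show ?thesis
      using u aL bL k by (auto simp: cyc_monom_mult_def cyc_monom_def cyc_norm_add comm_pow m_ac)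
  next
    case False
    \<comment> \<open>Splitting \<open>i + j\<close> in two ways produces the full norm
      \<open>cyc_norm k n\<close>, which combines with \<open>b\<close> to give
      \<open>\<tau> a\<close>.\<close>
    have "cyc_norm k (i + j) = cyc_norm k (n + (i + j - n))"
      using False by simp
    then have N: "cyc_norm k i \<otimes> (\<sigma> ^^ i) (cyc_norm k j) = cyc_norm k n \<otimes> cyc_norm k (i + j - n)"
      unfolding cyc_norm_add[OF k(1)] by (simp add: \<sigma>_pow_n k)
    have "\<tau> l \<otimes> cyc_norm k i \<otimes> (\<sigma> ^^ i) (\<tau> m \<otimes> cyc_norm k j) \<otimes> b =
        \<tau> l \<otimes> (\<sigma> ^^ i) (\<tau> m) \<otimes> (cyc_norm k i \<otimes> (\<sigma> ^^ i) (cyc_norm k j)) \<otimes> b"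
      using k bL by (simp add: m_ac)
    also have "\<dots> = \<tau> (l \<otimes> (\<sigma> ^^ i) m \<otimes> a) \<otimes> cyc_norm k (i + j - n)"
      unfolding N using k aL bL by (simp add: eq comm_pow m_ac)
    finally show ?thesis
      using False u aL bL k by (simp add: cyc_monom_mult_def cyc_monom_def)
  qed
  have hom: "?h \<in> ring_hom (A a) (A b)"
  proof (rule ring_hom_memI)
    fix x y assume x: "x \<in> carrier (A a)" and y: "y \<in> carrier (A a)"
    show "?h x \<in> carrier (A b)" by (rule h_closed[OF x])
    show "?h (x \<otimes>\<^bsub>A a\<^esub> y) = ?h x \<otimes>\<^bsub>A b\<^esub> ?h y"
    proof (rule carrier_A_eqI[of _ b _ b])
      fix u assume u: "u < n"
      let ?c = "\<lambda>i j. cyc_monom_mult L n \<sigma> a (x i) i (y j) j u"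
      have "?h (x \<otimes>\<^bsub>A a\<^esub> y) u = \<tau> (\<Oplus>i\<in>{..<n}. \<Oplus>j\<in>{..<n}. ?c i j) \<otimes> cyc_norm k u"
        using u by (simp add: A_mult_coeff)
      also have "\<tau> (\<Oplus>i\<in>{..<n}. \<Oplus>j\<in>{..<n}. ?c i j) = (\<Oplus>i\<in>{..<n}. \<Oplus>j\<in>{..<n}. \<tau> (?c i j))"
        using u x y aL by (subst \<tau>_sum) (auto intro!: finsum_cong' \<tau>_sum)
      also have "\<dots> \<otimes> cyc_norm k u = (\<Oplus>i\<in>{..<n}. (\<Oplus>j\<in>{..<n}. \<tau> (?c i j)) \<otimes> cyc_norm k u)"
        using u x y aL k by (intro finsum_ldistr) auto
      also have "\<dots> = (\<Oplus>i\<in>{..<n}. \<Oplus>j\<in>{..<n}. \<tau> (?c i j) \<otimes> cyc_norm k u)"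
        using u x y aL k by (intro finsum_cong' refl finsum_ldistr) auto
      also have "\<dots> = (\<Oplus>i\<in>{..<n}. \<Oplus>j\<in>{..<n}. cyc_monom_mult L n \<sigma> b (?h x i) i (?h y j) j u)"
        using u x y bL k by (intro finsum_cong' refl) (auto simp: mono)
      finally show "?h (x \<otimes>\<^bsub>A a\<^esub> y) u = (?h x \<otimes>\<^bsub>A b\<^esub> ?h y) u"
        using u by (simp add: A_mult_coeff)
    qed (use h_closed x y aL bL in \<open>auto intro!: A_closed\<close>)
    show "?h (x \<oplus>\<^bsub>A a\<^esub> y) = ?h x \<oplus>\<^bsub>A b\<^esub> ?h y"
    proof (rule carrier_A_eqI[of _ b _ b])
      fix u assume u: "u < n"
      then show "?h (x \<oplus>\<^bsub>A a\<^esub> y) u = (?h x \<oplus>\<^bsub>A b\<^esub> ?h y) u"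
        using x y k by (simp add: A_add_coeff l_distr)
    qed (use h_closed x y aL bL in \<open>auto intro!: A_closed\<close>)
  next
    show "?h \<one>\<^bsub>A a\<^esub> = \<one>\<^bsub>A b\<^esub>"
      by (rule carrier_A_eqI[of _ b _ b]) (use k h_closed in \<open>auto simp: A_one monom_coeff\<close>)
  qed
  have lin: "?h (c \<odot>\<^bsub>A a\<^esub> x) = c \<odot>\<^bsub>A b\<^esub> ?h x" if c: "c \<in> F" and x: "x \<in> carrier (A a)" for c x
  proof (rule carrier_A_eqI[of _ b _ b])
    have cL: "c \<in> carrier L" using c F_subset by auto
    then show "?h (c \<odot>\<^bsub>A a\<^esub> x) \<in> carrier (A b)" "c \<odot>\<^bsub>A b\<^esub> ?h x \<in> carrier (A b)"
      using x h_closed aL bL by (auto intro!: A_closed)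
    fix u assume "u < n"
    then show "?h (c \<odot>\<^bsub>A a\<^esub> x) u = (c \<odot>\<^bsub>A b\<^esub> ?h x) u"
      using c cL x k by (simp add: A_smult_coeff \<tau>(3) m_assoc)
  qed
  have "bij_betw ?h (carrier (A a)) (carrier (A b))"
  proof (rule bij_betw_imageI)
    show "inj_on ?h (carrier (A a))"
    proof (rule inj_onI)
      fix x y assume x: "x \<in> carrier (A a)" and y: "y \<in> carrier (A a)" and h: "?h x = ?h y"
      show "x = y"
      proof (rule carrier_A_eqI[OF x y])
        fix i assume i: "i < n"
        then have "\<tau> (x i) \<otimes> cyc_norm k i = \<tau> (y i) \<otimes> cyc_norm k i"
          using fun_cong[OF h, of i] by simp
        then have "\<tau> (x i) = \<tau> (y i)"
          using x y i k norm0 by (simp add: m_rcancel)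
        then show "x i = y i"
          using x y i bij_betw_imp_inj_on[OF \<tau>(2)] by (simp add: inj_on_eq_iff)
      qed
    qed
    have "y \<in> ?h ` carrier (A a)" if y: "y \<in> carrier (A b)" for y
    proof -
      \<comment> \<open>Surjectivity is solved coefficientwise, \<open>cyc_norm k i\<close> being a
        unit and \<open>\<tau>\<close> being onto.\<close>
      have "\<exists>v\<in>carrier L. \<tau> v \<otimes> cyc_norm k i = y i" if i: "i < n" for i
      proof -
        have u: "cyc_norm k i \<in> Units L"
          using k norm0 by (simp add: field_Units)
        then have "y i \<otimes> inv (cyc_norm k i) \<in> \<tau> ` carrier L"
          using bij_betw_imp_surj_on[OF \<tau>(2)] y i by simp
        then obtain v where v: "v \<in> carrier L" "\<tau> v = y i \<otimes> inv (cyc_norm k i)"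
          by auto
        moreover have "y i \<otimes> inv (cyc_norm k i) \<otimes> cyc_norm k i = y i"
          using u y i k by (simp add: m_assoc Units_l_inv)
        ultimately show ?thesis
          by (intro bexI[of _ v]) simp_all
      qed
      then obtain x where x: "\<And>i. i < n \<Longrightarrow> x i \<in> carrier L \<and> \<tau> (x i) \<otimes> cyc_norm k i = y i"
        by metis
      have r: "restrict x {..<n} \<in> carrier (A a)"
        using x by (auto simp: carrier_A)
      have "y = ?h (restrict x {..<n})"
        by (rule carrier_A_eqI[OF y h_closed[OF r]]) (simp add: x)
      then show ?thesis
        using r by blast
    qed
    then show "?h ` carrier (A a) = carrier (A b)"
      using h_closed by blast
  qed
  with hom lin show ?thesis
    by (simp add: algebra_iso_def ring_iso_def)
qed

end

section \<open>Isomorphism classes\<close>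

lemma carrier_galois_group:
  "carrier (galois_group L F) = {\<tau> \<in> Bij (carrier L). \<tau> \<in> ring_hom L L \<and> (\<forall>x\<in>F. \<tau> x = x)}"
  by (simp add: galois_group_def)

text \<open>Used to exclude the identity as a generator. The inverse of the identity is computed
  straight from the definition of \<open>m_inv\<close>.\<close>

lemma galois_group_generate_one:
  assumes "ring L" "F \<subseteq> carrier L"
  shows "generate (galois_group L F) {\<one>\<^bsub>galois_group L F\<^esub>} = {\<one>\<^bsub>galois_group L F\<^esub>}"
proof
  interpret ring L by fact
  let ?G = "galois_group L F"
  define e where "e = (\<lambda>x\<in>carrier L. x)"
  have one: "\<one>\<^bsub>?G\<^esub> = e"
    by (simp add: galois_group_def BijGroup_def e_def)
  have mult: "e \<otimes>\<^bsub>?G\<^esub> f = f" if "f \<in> Bij (carrier L)" for f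
    using that id_Bij[of "carrier L"] Bij_imp_funcset[OF that] Bij_imp_extensional[OF that]
    by (simp add: galois_group_def BijGroup_def e_def)
  have eG: "e \<in> carrier ?G"
    using assms id_Bij[of "carrier L"]
    by (auto simp: e_def carrier_galois_group intro!: ring_hom_memI)
  have ee: "e \<otimes>\<^bsub>?G\<^esub> e = e"
    using mult[OF id_Bij] by (simp only: e_def)
  have inv_e: "inv\<^bsub>?G\<^esub> e = e"
    unfolding m_inv_def one
  proof (rule the_equality)
    show "e \<in> carrier ?G \<and> e \<otimes>\<^bsub>?G\<^esub> e = e \<and> e \<otimes>\<^bsub>?G\<^esub> e = e"
      using eG ee by blast
    show "y = e" if "y \<in> carrier ?G \<and> e \<otimes>\<^bsub>?G\<^esub> y = e \<and> y \<otimes>\<^bsub>?G\<^esub> e = e" for y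
      using that mult[of y] by (simp add: carrier_galois_group)
  qed
  show "generate ?G {\<one>\<^bsub>?G\<^esub>} \<subseteq> {\<one>\<^bsub>?G\<^esub>}"
  proof
    fix f assume "f \<in> generate ?G {\<one>\<^bsub>?G\<^esub>}"
    then show "f \<in> {\<one>\<^bsub>?G\<^esub>}"
      unfolding one by induction (simp_all add: one inv_e ee)
  qed
  show "{\<one>\<^bsub>?G\<^esub>} \<subseteq> generate ?G {\<one>\<^bsub>?G\<^esub>}"
    by (simp add: generate.one)
qed

context finite_field_extension
begin

section \<open>Galois generators as Frobenius powers, and the classes as orbits\<close>

lemma pow_q_in_galois_group: "(\<lambda>x\<in>carrier L. x [^] (q ^ t)) \<in> carrier (galois_group L F)"
proof -
  have "bij_betw (\<lambda>x\<in>carrier L. x [^] (q ^ t)) (carrier L) (carrier L)"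
    by (rule bij_betw_cong[THEN iffD1, OF _ pow_q_bij[of t]]) simp
  moreover have "(\<lambda>x\<in>carrier L. x [^] (q ^ t)) \<in> ring_hom L L"
    by (rule ring_hom_memI) (simp_all add: nat_pow_distrib pow_q_add)
  moreover have "(\<lambda>x\<in>carrier L. x [^] (q ^ t)) c = c" if "c \<in> F" for c
    using that F_subset by (auto simp: pow_q_F)
  ultimately show ?thesis
    by (simp add: carrier_galois_group Bij_def)
qed

text \<open>Exponent 0 would make the generated group trivial, yet the Frobenius map moves
  \<open>gen\<close>. The other exponents below \<open>r\<close> are not divisible by
  \<open>r\<close>.\<close>

lemma generator_eq_pow_q:
  fixes \<sigma> :: "'a \<Rightarrow> 'a"
  assumes \<sigma>: "\<sigma> \<in> carrier (galois_group L F)"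
    and gen_\<sigma>: "generate (galois_group L F) {\<sigma>} = carrier (galois_group L F)"
  obtains j where "\<not> r dvd j" "\<And>x. x \<in> carrier L \<Longrightarrow> \<sigma> x = x [^] (q ^ j)"
proof -
  have \<sigma>': "\<sigma> \<in> Bij (carrier L)" "\<sigma> \<in> ring_hom L L" "\<And>c. c \<in> F \<Longrightarrow> \<sigma> c = c"
    using \<sigma> by (auto simp: carrier_galois_group)
  obtain j where j: "j < r" "\<And>x. x \<in> carrier L \<Longrightarrow> \<sigma> x = x [^] (q ^ j)"
    using automorphism_eq_pow_q[OF \<sigma>'(2,3)] by blast
  have "j \<noteq> 0"
  proof
    assume "j = 0"
    then have "\<sigma> = \<one>\<^bsub>galois_group L F\<^esub>"
      using Bij_imp_extensional[OF \<sigma>'(1)] j(2)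
      by (intro extensionalityI[of _ "carrier L"]) (auto simp: galois_group_def BijGroup_def)
    then have "carrier (galois_group L F) \<subseteq> {\<sigma>}"
      using galois_group_generate_one[OF ring_axioms F_subset] gen_\<sigma> by simp
    then have "(\<lambda>x\<in>carrier L. x [^] (q ^ 1)) = \<sigma>"
      using pow_q_in_galois_group[of 1] by blast
    then have "gen [^] (q ^ 1) = \<sigma> gen"
      using gen(1) by (metis restrict_apply')
    then have "gen [^] (q ^ 1) = gen [^] (q ^ 0)"
      using j(2)[OF gen(1)] \<open>j = 0\<close> by simp
    then show False
      using pow_q_gen_inj[of 1 0] r_gt_1 by (simp add: cong_def)
  qed
  then have "\<not> r dvd j"
    using j(1) by (auto dest: dvd_imp_le)
  then show ?thesis
    using j(2) that by blast
qed

text \<open>An isomorphism gives \<open>a [^] (q ^ t) = N(k) \<otimes> b\<close> with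
  \<open>N(k)\<close> in \<open>F\<close>, so \<open>c\<close> is the inverse of
  \<open>N(k)\<close>; conversely surjectivity of the norm supplies a \<open>k\<close> for every
  \<open>c\<close>.\<close>

lemma cyclic_algebra_class_eq:
  fixes \<sigma> :: "'a \<Rightarrow> 'a"
  assumes \<sigma>: "\<sigma> \<in> carrier (galois_group L F)"
    and gen_\<sigma>: "generate (galois_group L F) {\<sigma>} = carrier (galois_group L F)"
    and a: "a \<in> carrier L - F"
  shows "cyclic_algebra_rel L F \<sigma> `` {a} = (\<lambda>(t, c). c \<otimes> a [^] (q ^ t)) ` ({..<r} \<times> (F - {\<zero>}))"
proof -
  obtain j where j: "\<not> r dvd j" and \<sigma>_eq: "\<And>x. x \<in> carrier L \<Longrightarrow> \<sigma> x = x [^] (q ^ j)"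
    using generator_eq_pow_q[OF \<sigma> gen_\<sigma>] by blast
  have \<sigma>_pow: "(\<sigma> ^^ i) x = x [^] (q ^ (i * j))" if "x \<in> carrier L" for i x
    using that by (induction i) (simp_all add: \<sigma>_eq nat_pow_pow power_add mult.commute)
  \<comment> \<open>The eigenvector lemma with \<open>c = \<one>\<close> returns
    \<open>d = \<one>\<close>, so \<open>x\<close> is fixed by the Frobenius map itself.\<close>
  have F_mem: "x \<in> F" if x: "x \<in> carrier L" "x [^] (q ^ s) = x" "\<not> r dvd s" for x s
  proof -
    obtain d where "x [^] q = d \<otimes> x" "d = \<one>"
      using pow_q_eigenvector[of x \<one> s] x F_closed(2) by auto
    then show ?thesis
      using x by (simp add: mem_F_iff)
  qed
  interpret nonassoc_cyclic L F \<sigma> r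
  proof unfold_locales
    show "F \<subseteq> carrier L" by (rule F_subset)
    show "\<sigma> \<in> ring_hom L L" using \<sigma> by (simp add: carrier_galois_group)
    show "ext_degree L F = r" by (rule ext_degree_eq)
    show "1 < r" by (rule r_gt_1)
    show "(\<sigma> ^^ r) x = x" if "x \<in> carrier L" for x
      using that pow_q_mod[OF that, of "r * j"] by (simp add: \<sigma>_pow)
    show "(\<sigma> ^^ i) x \<noteq> x" if x: "x \<in> carrier L - F" and "0 < i" "i < r" for x i
    proof -
      have "\<not> r dvd i * j"
        using that j prime_r by (auto simp: prime_dvd_mult_iff dest: dvd_imp_le)
      then show ?thesis
        using F_mem[of x "i * j"] x by (auto simp: \<sigma>_pow)
    qed
  qed
  have comm: "\<tau> (\<sigma> x) = \<sigma> (\<tau> x)"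
    if \<tau>: "\<tau> \<in> ring_hom L L" "\<And>c. c \<in> F \<Longrightarrow> \<tau> c = c" and x: "x \<in> carrier L" for \<tau> x
  proof -
    obtain t where "\<And>x. x \<in> carrier L \<Longrightarrow> \<tau> x = x [^] (q ^ t)"
      using automorphism_eq_pow_q[OF \<tau>] by blast
    then show ?thesis
      using x by (simp add: \<sigma>_eq nat_pow_pow mult.commute)
  qed
  have cyc_norm_eq: "cyc_norm k i = k [^] (\<Sum>s<i. q ^ (j * s))" if k: "k \<in> carrier L" for k i
  proof (induction i)
    case (Suc i)
    have "(\<Sum>s<Suc i. q ^ (j * s)) = 1 + (\<Sum>s<i. q ^ (j * s)) * q ^ j"
      by (subst sum.lessThan_Suc_shift) (simp add: power_add sum_distrib_left mult.commute)
    then show ?case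
      using k by (simp add: Suc \<sigma>_eq nat_pow_pow m_comm)
  qed simp
  have norm_F: "cyc_norm k r \<in> F" if k: "k \<in> carrier L" for k
  proof (cases "k = \<zero>")
    case True
    then show ?thesis
      using r_gt_1 F_closed(1) by (cases r) auto
  next
    case False
    \<comment> \<open>Expanding \<open>cyc_norm k (r + 1)\<close> from either end and cancelling
      \<open>k\<close> shows that the norm is fixed by \<open>\<sigma>\<close>.\<close>
    have "k \<otimes> \<sigma> (cyc_norm k r) = cyc_norm k r \<otimes> cyc_norm k 1"
      using cyc_norm_add[of k r 1] k \<sigma>_pow_n[of "cyc_norm k 1"] by simp
    then have "\<sigma> (cyc_norm k r) = cyc_norm k r"
      using k False m_comm[of "cyc_norm k r" k] by (simp add: m_lcancel)
    then show ?thesis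
      using F_mem[of "cyc_norm k r" j] k j by (simp add: \<sigma>_eq)
  qed
  have FL: "c \<in> carrier L" if "c \<in> F" for c
    using that F_subset by auto
  show ?thesis
  proof (intro equalityI subsetI)
    fix b assume "b \<in> cyclic_algebra_rel L F \<sigma> `` {a}"
    then obtain h where b: "b \<in> carrier L - F" and h: "h \<in> algebra_iso F (A a) (A b)"
      by (auto simp: cyclic_algebra_rel_def)
    obtain \<tau> k where \<tau>: "\<tau> \<in> ring_hom L L" "\<And>c. c \<in> F \<Longrightarrow> \<tau> c = c"
      and k: "k \<in> carrier L" "k \<noteq> \<zero>" and eq: "\<tau> a = cyc_norm k r \<otimes> b"
      using iso_imp_norm_eq[OF a b h comm] by blast
    obtain t where t: "t < r" "\<And>x. x \<in> carrier L \<Longrightarrow> \<tau> x = x [^] (q ^ t)"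
      using automorphism_eq_pow_q[OF \<tau>] by blast
    have N: "cyc_norm k r \<in> carrier L" "cyc_norm k r \<noteq> \<zero>"
      using k cyc_norm_nonzero by auto
    have "b = inv (cyc_norm k r) \<otimes> (cyc_norm k r \<otimes> b)"
      using inv_nonzero[OF N] N b by (simp add: m_assoc[symmetric])
    also have "\<dots> = inv (cyc_norm k r) \<otimes> a [^] (q ^ t)"
      using eq t(2)[of a] a by simp
    finally show "b \<in> (\<lambda>(t, c). c \<otimes> a [^] (q ^ t)) ` ({..<r} \<times> (F - {\<zero>}))"
      using t(1) F_inv[OF norm_F[OF k(1)] N(2)] inv_nonzero[OF N]
      by (intro image_eqI[of _ _ "(t, inv (cyc_norm k r))"]) auto
  next
    fix b assume "b \<in> (\<lambda>(t, c). c \<otimes> a [^] (q ^ t)) ` ({..<r} \<times> (F - {\<zero>}))"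
    then obtain t c where t: "t < r" and c: "c \<in> F" "c \<noteq> \<zero>" and b_eq: "b = c \<otimes> a [^] (q ^ t)"
      by auto
    have bL: "b \<in> carrier L"
      using c a FL by (simp add: b_eq)
    have ab: "a [^] (q ^ t) = inv c \<otimes> b"
      using c FL a inv_nonzero[of c] by (simp add: b_eq m_assoc[symmetric])
    have "b \<notin> F"
    proof
      assume "b \<in> F"
      then have "a [^] (q ^ t) \<in> F"
        using ab F_closed(3) F_inv[OF c] by simp
      \<comment> \<open>Frobenius powers commute and are injective, so \<open>a\<close> itself would
        lie in \<open>F\<close>.\<close>
      then have "(a [^] q) [^] (q ^ t) = a [^] (q ^ t)"
        using a by (simp add: mem_F_iff nat_pow_pow mult.commute)
      then have "a [^] q = a"
        using a pow_q_inj by simp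
      then show False
        using a by (simp add: mem_F_iff)
    qed
    \<comment> \<open>The norm of \<open>k\<close> must be \<open>inv c\<close>, because
      \<open>a [^] (q ^ t) = inv c \<otimes> b\<close>.\<close>
    obtain k where k: "k \<in> carrier L" "k \<noteq> \<zero>" "k [^] (\<Sum>s<r. q ^ (j * s)) = inv c"
      using norm_surj[OF F_inv[OF c] _ j] inv_nonzero[of c] c FL by blast
    have "(\<lambda>x. \<lambda>i\<in>{..<r}. x i [^] (q ^ t) \<otimes> cyc_norm k i) \<in> algebra_iso F (A a) (A b)"
    proof (rule norm_eq_imp_iso[OF _ bL pow_q_ring_hom pow_q_bij _ _ k(1,2)])
      show "a [^] (q ^ t) = cyc_norm k r \<otimes> b"
        using k by (simp add: ab cyc_norm_eq)
    qed (use a in \<open>auto simp: pow_q_F \<sigma>_eq nat_pow_pow mult.commute\<close>)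
    then show "b \<in> cyclic_algebra_rel L F \<sigma> `` {a}"
      using a bL \<open>b \<notin> F\<close> by (auto simp: cyclic_algebra_rel_def)
  qed
qed

end

theorem theorem3p5:
  fixes L :: "('a, 'm) ring_scheme" and F :: "'a set" and \<sigma> :: "'a \<Rightarrow> 'a" and q r :: nat
  assumes "field L" and "subfield F L"
    and "primepow q" and "card F = q"
    and "Factorial_Ring.prime r" and "ring.dimension L r F (carrier L)"
    and "\<sigma> \<in> carrier (galois_group L F)"
    and "generate (galois_group L F) {\<sigma>} = carrier (galois_group L F)"
  shows "(r dvd q - 1 \<longrightarrow>
        real (card ((carrier L - F) // cyclic_algebra_rel L F \<sigma>)) =
          real r - 1 + (real q ^ r - real q - (real q - 1) * (real r - 1)) / (real r * (real q - 1)))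
    \<and> (\<not> r dvd q - 1 \<longrightarrow>
        real (card ((carrier L - F) // cyclic_algebra_rel L F \<sigma>)) =
          (real q ^ r - real q) / (real r * (real q - 1)))"
proof -
  interpret finite_field_extension L F q r
    using assms by (intro finite_field_extension.intro finite_field_extension_axioms.intro)
  have "\<sigma> \<in> carrier L \<rightarrow> carrier L"
    using assms(7) by (auto simp: carrier_galois_group dest: ring_hom_closed)
  then have "equiv (carrier L - F) (cyclic_algebra_rel L F \<sigma>)"
    by (intro equiv_cyclic_algebra_rel ring_axioms F_subset)
  \<comment> \<open>The count contains \<open>gcd r (q - 1)\<close>, which is \<open>r\<close> or 1
    because \<open>r\<close> is prime.\<close>
  note card = card_quotient[OF this cyclic_algebra_class_eq[OF assms(7,8)]]
  show ?thesis
  proof (intro conjI impI)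
    assume "r dvd q - 1"
    then have "gcd r (q - 1) = r"
      by (simp add: gcd_nat.absorb1)
    then show "real (card ((carrier L - F) // cyclic_algebra_rel L F \<sigma>)) =
      real r - 1 + (real q ^ r - real q - (real q - 1) * (real r - 1)) / (real r * (real q - 1))"
      using card r_gt_1 by (simp add: of_nat_diff)
  next
    assume "\<not> r dvd q - 1"
    then have "gcd r (q - 1) = 1"
      using prime_imp_coprime[OF prime_r] by (simp only: coprime_iff_gcd_eq_1)
    then show "real (card ((carrier L - F) // cyclic_algebra_rel L F \<sigma>)) =
      (real q ^ r - real q) / (real r * (real q - 1))"
      using card by simp
  qed
qed

end
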